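(* Let $N\ge 3$, $q>1$, $\lambda,\theta\in\mathbb R$, and let $\Omega_0\subseteq\mathbb R^N$ be an open set containing $0$. Assume that one of the following holds: ($\mathcal U$) $\lambda>\lambda_H$ (and $\theta\in\mathbb R$ arbitrary); or ($\mathcal M_1$) $\lambda\le\lambda_H$ and $\theta<\theta_-$. Then every solution $u$ of $$-\Delta u-\frac{\lambda}{|x|^2}u+|x|^{\theta}u^q=0\quad\text{in }\Omega_0\setminus\{0\},\qquad u>0\quad\text{in }\Omega_0\setminus\{0\},$$ satisfies $$\lim_{|x|\to0}\frac{u(x)}{U_0(x)}=1.$$
   Context: Notation: $\lambda_H:=(N-2)^2/4$; for $\lambda\le\lambda_H$, $p_\pm:=\frac{N-2}{2}\pm\sqrt{\lambda_H-\lambda}$ and $\theta_\pm:=p_\pm(q-1)-2$. Also $\Theta:=\frac{\theta+2}{q-1}$, $\ell:=\Theta^2-(N-2)\Theta+\lambda$ (which is positive in the cases considered) and $U_0(x):=\ell^{1/(q-1)}|x|^{-\Theta}$ for $x\in\mathbb R^N\setminus\{0\}$. A solution in $\Omega_0\setminus\{0\}$ is a positive function $u\in C^1(\Omega_0\setminus\{0\})$ such that for every $\varphi\in C^1_c(\Omega_0\setminus\{0\})$, $$\int\nabla u\cdot\nabla\varphi\,dx-\int\frac{\lambda}{|x|^2}u\,\varphi\,dx+\int|x|^\theta u^q\varphi\,dx=0,$$ the integrals being over $\Omega_0$. *)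

theory Defs
  imports "HOL-Analysis.Analysis"
begin

definition grad :: "('a::real_inner \<Rightarrow> real) \<Rightarrow> 'a \<Rightarrow> 'a" where
  "grad f x = (THE D. GDERIV f x :> D)"

lemma grad_eqI:
  assumes "GDERIV f x :> D"
  shows "grad f x = D"
  unfolding grad_def
proof (rule the_equality)
  show "GDERIV f x :> D" by fact
next
  fix E assume "GDERIV f x :> E"
  with assms have "(\<lambda>h. inner h D) = (\<lambda>h. inner h E)"
    unfolding gderiv_def by (rule has_derivative_unique)
  then have "\<And>h. inner h D = inner h E" by (rule fun_cong)
  then show "E = D" by (metis vector_eq_ldot)
qed

lemma GDERIV_grad:
  fixes f :: "'a::euclidean_space \<Rightarrow> real"
  assumes "f differentiable (at x)"
  shows "GDERIV f x :> grad f x"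
proof -
  obtain F where F: "(f has_derivative F) (at x)"
    using assms by (auto simp: differentiable_def)
  then interpret F: linear F by (rule has_derivative_linear)
  define D where "D = (\<Sum>b\<in>Basis. F b *\<^sub>R b)"
  have "F h = inner h D" for h
  proof -
    have "F h = F (\<Sum>b\<in>Basis. inner h b *\<^sub>R b)" by (simp add: euclidean_representation)
    also have "\<dots> = inner h D"
      by (simp add: F.sum F.scale D_def inner_sum_right mult.commute)
    finally show ?thesis .
  qed
  then have "F = (\<lambda>h. inner h D)" by blast
  with F have "GDERIV f x :> D" by (simp add: gderiv_def)
  with grad_eqI show ?thesis by metis
qed

text \<open>Intended for open \<open>U\<close>; values of the function outside \<open>U\<close> are irrelevant.\<close>
definition C1_on :: "'a::euclidean_space set \<Rightarrow> ('a \<Rightarrow> real) \<Rightarrow> bool" where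
  "C1_on U f \<longleftrightarrow> (\<forall>x\<in>U. f differentiable (at x)) \<and> continuous_on U (grad f)"

text \<open>A function in \<open>C\<^sup>1\<^sub>c(U)\<close> is represented by its extension by zero to the whole space.\<close>
definition C1_compact_support :: "'a::euclidean_space set \<Rightarrow> ('a \<Rightarrow> real) \<Rightarrow> bool" where
  "C1_compact_support U f \<longleftrightarrow>
     C1_on U f \<and> compact (closure {x. f x \<noteq> 0}) \<and> closure {x. f x \<noteq> 0} \<subseteq> U"

definition lambda_H :: "nat \<Rightarrow> real" where
  "lambda_H N = (real N - 2)\<^sup>2 / 4"

text \<open>\<open>p_minus\<close> and \<open>theta_minus\<close> are meaningful only for \<open>lam \<le> lambda_H N\<close>.\<close>
definition p_minus :: "nat \<Rightarrow> real \<Rightarrow> real" where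
  "p_minus N lam = (real N - 2) / 2 - sqrt (lambda_H N - lam)"

definition theta_minus :: "nat \<Rightarrow> real \<Rightarrow> real \<Rightarrow> real" where
  "theta_minus N lam q = p_minus N lam * (q - 1) - 2"

definition Theta :: "real \<Rightarrow> real \<Rightarrow> real" where
  "Theta q \<theta> = (\<theta> + 2) / (q - 1)"

definition ell :: "nat \<Rightarrow> real \<Rightarrow> real \<Rightarrow> real \<Rightarrow> real" where
  "ell N lam q \<theta> = (Theta q \<theta>)\<^sup>2 - (real N - 2) * Theta q \<theta> + lam"

definition U0 :: "real \<Rightarrow> real \<Rightarrow> real \<Rightarrow> real ^ 'n \<Rightarrow> real" where
  "U0 lam q \<theta> x = ell CARD('n) lam q \<theta> powr (1 / (q - 1)) * norm x powr (- Theta q \<theta>)"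

text \<open>Positive weak solutions of \<open>-\<Delta>u - lam |x|\<^sup>-\<^sup>2 u + |x|\<^sup>\<theta> u\<^sup>q = 0\<close> in \<open>\<Omega> - {0}\<close>. The value of \<open>u\<close>
  at \<open>0\<close> is unconstrained; it does not affect the integrals, \<open>{0}\<close> being a null set.\<close>
definition is_solution ::
  "(real ^ 'n) set \<Rightarrow> real \<Rightarrow> real \<Rightarrow> real \<Rightarrow> (real ^ 'n \<Rightarrow> real) \<Rightarrow> bool" where
  "is_solution \<Omega> lam q \<theta> u \<longleftrightarrow>
     C1_on (\<Omega> - {0}) u \<and> (\<forall>x\<in>\<Omega> - {0}. u x > 0) \<and>
     (\<forall>\<phi>. C1_compact_support (\<Omega> - {0}) \<phi> \<longrightarrow>
        (LINT x:\<Omega>|lborel. grad u x \<bullet> grad \<phi> x)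
        - (LINT x:\<Omega>|lborel. lam / (norm x)\<^sup>2 * u x * \<phi> x)
        + (LINT x:\<Omega>|lborel. norm x powr \<theta> * u x powr q * \<phi> x) = 0)"

end

theory Submission
  imports Defs
begin

text \<open>Put \<open>s = ln |x|\<close> and \<open>v = |x|\<^sup>\<Theta> u\<close>. On a half-cylinder \<open>v\<close> solves the autonomous equation
  \<open>v\<^sub>s\<^sub>s + a v\<^sub>s + \<Delta>\<^sub>S v + \<ell> v - v\<^sup>q = 0\<close> with \<open>a = N - 2 - 2\<Theta>\<close>, and the claim is
  \<open>v \<rightarrow> \<ell>\<^bsup>1/(q-1)\<^esup>\<close> as \<open>s \<rightarrow> -\<infinity>\<close>. A weak \<open>C\<^sup>1\<close> solution is a viscosity solution, so it can be
  compared with explicit radial functions on long annuli \<open>|s - s\<^sub>1| \<le> R\<close>: a Keller--Osserman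
  function that blows up at both ends bounds \<open>v\<close> from above, and a concave parabola bounds it from
  below as soon as \<open>v\<close> stays away from \<open>0\<close>. The latter is where the two cases differ. For
  \<open>\<lambda> > \<lambda>\<^sub>H\<close> the linearisation at \<open>0\<close> oscillates and one arch of a damped cosine is a
  subsolution; for \<open>\<theta> < \<theta>\<^sub>-\<close> one has \<open>a > 0\<close> and \<open>\<ell> > 0\<close>, and \<open>c (1 - e\<^bsup>a(s\<^sub>1-s)\<^esup>)\<close> is one.\<close>

section \<open>Integration by parts\<close>

lemma integrable_compact_support:
  fixes h :: "'a::euclidean_space \<Rightarrow> 'b::{banach, second_countable_topology}"
  assumes "compact K" "continuous_on K h" "\<And>x. x \<notin> K \<Longrightarrow> h x = 0"
  shows "integrable lborel h"
proof -
  have "(\<lambda>x. indicator K x *\<^sub>R h x) = h"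
    using assms(3) by (auto simp: indicator_def fun_eq_iff)
  with borel_integrable_compact[OF assms(1,2)] show ?thesis by simp
qed

lemma integral_lborel_translate:
  fixes f :: "'a::euclidean_space \<Rightarrow> real"
  assumes "f \<in> borel_measurable borel"
  shows "(LINT x|lborel. f (x + c)) = (LINT x|lborel. f x)"
proof -
  have "(LINT x|lborel. f x) = (LINT x|distr lborel borel ((+) c). f x)"
    by (simp only: lborel_distr_plus)
  also have "\<dots> = (LINT x|lborel. f (c + x))"
    using assms by (intro integral_distr) auto
  finally show ?thesis by (simp add: add.commute)
qed

text \<open>By translation invariance every difference quotient of \<open>f\<close> along
  \<open>e\<close> has integral zero, and dominated convergence carries this to the limit. No Fubini
  argument or choice of coordinates is involved, and only the one directional derivative has to be
  continuous.\<close>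

lemma integral_directional_derivative_eq_0:
  fixes f :: "'a::euclidean_space \<Rightarrow> real"
  assumes der: "\<And>x. (f has_derivative f' x) (at x)"
    and cont: "continuous_on UNIV (\<lambda>x. f' x e)"
    and K: "compact K" "\<And>x. x \<notin> K \<Longrightarrow> f x = 0"
  shows "(LINT x|lborel. f' x e) = 0"
proof -
  have f'0: "f' x e = 0" if "x \<notin> K" for x
  proof -
    have "open (- K)" using K(1) by (simp add: compact_imp_closed open_Compl)
    moreover have "((\<lambda>x. 0) has_derivative (\<lambda>h. 0)) (at x)" by simp
    ultimately have "(f has_derivative (\<lambda>h. 0)) (at x)"
      using has_derivative_transform_within_open[of "\<lambda>x. 0" "\<lambda>h. 0" x UNIV "- K" f] K(2) that by auto
    with der[of x] have "f' x = (\<lambda>h. 0)" by (rule has_derivative_unique)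
    then show ?thesis by simp
  qed
  have contf: "continuous_on UNIV f"
    by (meson der has_derivative_continuous continuous_at_imp_continuous_on)
  then have fmeas [measurable]: "f \<in> borel_measurable borel"
    by (rule borel_measurable_continuous_onI)
  have intf: "integrable lborel f"
    using K continuous_on_subset[OF contf] by (auto intro!: integrable_compact_support)
  have "bounded ((\<lambda>x. f' x e) ` K)"
    using K(1) cont by (meson compact_continuous_image compact_imp_bounded continuous_on_subset subset_UNIV)
  then obtain B0 where B0: "\<And>x. x \<in> K \<Longrightarrow> \<bar>f' x e\<bar> \<le> B0"
    by (auto simp: bounded_iff)
  \<comment> \<open>The maximum with 0 makes the bound valid off \<open>K\<close> too, where the
    derivative is 0, even if \<open>K\<close> is empty and \<open>B0\<close> is negative.\<close>
  define B where "B = max B0 0"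
  have B: "\<bar>f' x e\<bar> \<le> B" for x
    using B0[of x] f'0[of x] by (cases "x \<in> K") (auto simp: B_def)
  obtain r where r: "\<And>x. x \<in> K \<Longrightarrow> norm x \<le> r"
    using compact_imp_bounded[OF K(1)] by (auto simp: bounded_iff)
  \<comment> \<open>The steps \<open>d n\<close> are at most 1, so for \<open>x\<close> outside this
    ball neither \<open>x\<close> nor \<open>x + d n *\<^sub>R e\<close> meets \<open>K\<close>. All
    difference quotients therefore live on \<open>C\<close>, where the mean value theorem bounds
    them by \<open>B\<close>.\<close>
  define C where "C = cball (0::'a) (r + norm e)"
  define d where "d n = inverse (real (Suc n))" for n
  have d: "d n > 0" "d n \<le> 1" for n by (auto simp: d_def field_simps)
  have line: "((\<lambda>t. f (x + t *\<^sub>R e)) has_real_derivative f' (x + t *\<^sub>R e) e) (at t)" for x t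
  proof -
    have "((\<lambda>t. f (x + t *\<^sub>R e)) has_derivative (\<lambda>s. f' (x + t *\<^sub>R e) (s *\<^sub>R e))) (at t)"
      by (rule has_derivative_compose[OF _ der]) (auto intro!: derivative_eq_intros)
    moreover have "f' (x + t *\<^sub>R e) (s *\<^sub>R e) = f' (x + t *\<^sub>R e) e * s" for s
      using linear_cmul[OF has_derivative_linear[OF der]] by simp
    ultimately show ?thesis by (simp add: has_field_derivative_def)
  qed
  define g where "g n x = (f (x + d n *\<^sub>R e) - f x) / d n" for n x
  have "(\<lambda>n. LINT x|lborel. g n x) \<longlonglongrightarrow> (LINT x|lborel. f' x e)"
  proof (rule integral_dominated_convergence)
    show "(\<lambda>x. f' x e) \<in> borel_measurable lborel"
      using cont by (simp add: borel_measurable_continuous_onI)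
    show "g n \<in> borel_measurable lborel" for n
      unfolding g_def by measurable
    show "integrable lborel (\<lambda>x. indicator C x *\<^sub>R B)"
      by (rule borel_integrable_compact) (auto simp: C_def)
    show "AE x in lborel. (\<lambda>n. g n x) \<longlonglongrightarrow> f' x e"
    proof (rule AE_I2)
      fix x
      have "((\<lambda>h. (f (x + h *\<^sub>R e) - f x) / h) \<longlongrightarrow> f' x e) (at 0)"
        using line[of x 0] by (simp add: has_field_derivative_iff)
      moreover have "filterlim d (at 0) sequentially"
        unfolding filterlim_at d_def using LIMSEQ_inverse_real_of_nat by auto
      ultimately show "(\<lambda>n. g n x) \<longlonglongrightarrow> f' x e"
        unfolding g_def by (rule filterlim_compose)
    qed
    show "AE x in lborel. norm (g n x) \<le> indicator C x *\<^sub>R B" for n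
    proof (rule AE_I2)
      fix x
      obtain t where "f (x + d n *\<^sub>R e) - f x = (d n - 0) * f' (x + t *\<^sub>R e) e"
        using MVT2[of 0 "d n" "\<lambda>t. f (x + t *\<^sub>R e)"] line d(1) by fastforce
      then have "g n x = f' (x + t *\<^sub>R e) e" using d(1)[of n] by (simp add: g_def)
      then have le: "\<bar>g n x\<bar> \<le> B" using B by simp
      moreover have "g n x = 0" if "x \<notin> C"
      proof -
        have big: "norm x > r + norm e" using that by (simp add: C_def)
        have "norm (d n *\<^sub>R e) \<le> norm e"
          using d[of n] by (simp add: mult_left_le_one_le)
        moreover have "norm x \<le> norm (x + d n *\<^sub>R e) + norm (d n *\<^sub>R e)"
          by (metis add_diff_cancel_right' norm_triangle_ineq4)
        ultimately have "norm (x + d n *\<^sub>R e) > r" using big by linarith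
        moreover have "norm x > r" using big norm_ge_zero[of e] by linarith
        ultimately have "x + d n *\<^sub>R e \<notin> K" "x \<notin> K" using r by (meson not_less)+
        then show ?thesis using K(2) by (simp add: g_def)
      qed
      ultimately show "norm (g n x) \<le> indicator C x *\<^sub>R B"
        by (auto simp: indicator_def)
    qed
  qed
  moreover have "(LINT x|lborel. g n x) = 0" for n
  proof -
    have "integrable lborel (\<lambda>x. f (x + d n *\<^sub>R e))"
    proof (rule integrable_compact_support)
      show "compact ((\<lambda>x. x - d n *\<^sub>R e) ` K)"
        using K(1) by (intro compact_continuous_image continuous_intros)
      show "continuous_on ((\<lambda>x. x - d n *\<^sub>R e) ` K) (\<lambda>x. f (x + d n *\<^sub>R e))"
        by (intro continuous_on_compose2[OF contf] continuous_intros) auto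
      show "f (x + d n *\<^sub>R e) = 0" if "x \<notin> (\<lambda>x. x - d n *\<^sub>R e) ` K" for x
        using that K(2) by (metis add_diff_cancel_right' image_eqI)
    qed
    with intf integral_lborel_translate[OF fmeas, of "d n *\<^sub>R e"] show ?thesis
      unfolding g_def by simp
  qed
  ultimately show ?thesis by (simp add: LIMSEQ_const_iff)
qed

text \<open>\<open>W\<close> and the complement of \<open>K\<close> form an open cover, and
  continuity is local. This serves functions given by a formula on \<open>W\<close> and extended by
  a constant.\<close>

lemma continuous_on_UNIV_cover:
  fixes h :: "'a::topological_space \<Rightarrow> 'b::topological_space"
  assumes "closed K" "open W" "K \<subseteq> W" "continuous_on W h" "\<And>x. x \<notin> K \<Longrightarrow> h x = c"
  shows "continuous_on UNIV h"
proof -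
  have "continuous_on (- K) h"
    using assms(5) by (metis ComplD continuous_on_cong continuous_on_const)
  then have "continuous_on (W \<union> - K) h"
    using assms by (intro continuous_on_open_Un) auto
  moreover have "W \<union> - K = UNIV" using assms(3) by auto
  ultimately show ?thesis by simp
qed

lemma gradient_eq_0_outside:
  fixes \<phi> :: "'a::euclidean_space \<Rightarrow> real"
  assumes "closed K" "\<And>x. x \<notin> K \<Longrightarrow> \<phi> x = 0" "x \<notin> K" "GDERIV \<phi> x :> D"
  shows "D = 0"
proof -
  have "((\<lambda>x. 0) has_derivative (\<lambda>h. 0)) (at x)" by simp
  then have "(\<phi> has_derivative (\<lambda>h. 0)) (at x)"
    using has_derivative_transform_within_open[of "\<lambda>x. 0" "\<lambda>h. 0" x UNIV "- K" \<phi>] assms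
    by (auto simp: open_Compl)
  then have "GDERIV \<phi> x :> 0" by (simp add: gderiv_def)
  then show ?thesis using assms(4) grad_eqI by metis
qed

text \<open>Each product of a component of \<open>G\<close> with \<open>\<phi>\<close> vanishes off
  \<open>K\<close>, hence is differentiable on the whole space although \<open>G\<close> is
  controlled only on \<open>W\<close>; the directional lemma applies to it. Here
  \<open>H b x\<close> is the derivative of the component of \<open>G\<close> along
  \<open>b\<close>, so the sum of \<open>H b x b\<close> is the divergence.\<close>

lemma integral_divergence_by_parts:
  fixes \<phi> :: "'a::euclidean_space \<Rightarrow> real" and G :: "'a \<Rightarrow> 'a"
  assumes \<phi>: "\<And>x. GDERIV \<phi> x :> \<phi>' x" "continuous_on UNIV \<phi>'"
    and K: "compact K" "K \<subseteq> W" "\<And>x. x \<notin> K \<Longrightarrow> \<phi> x = 0" and W: "open W"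
    and G: "\<And>x b. x \<in> W \<Longrightarrow> b \<in> Basis \<Longrightarrow> ((\<lambda>x. G x \<bullet> b) has_derivative H b x) (at x)"
    and H: "\<And>b. b \<in> Basis \<Longrightarrow> continuous_on W (\<lambda>x. H b x b)"
  shows "(LINT x|lborel. G x \<bullet> \<phi>' x) = - (LINT x|lborel. (\<Sum>b\<in>Basis. H b x b) * \<phi> x)"
proof -
  have clK: "closed K" using K(1) by (rule compact_imp_closed)
  have \<phi>'0: "\<phi>' x = 0" if "x \<notin> K" for x
    using gradient_eq_0_outside[OF clK K(3) that \<phi>(1)] .
  have nW: "\<phi>' x = 0" "\<phi> x = 0" if "x \<notin> W" for x
    using \<phi>'0 K(2,3) that by blast+
  have contphi: "continuous_on UNIV \<phi>"
    by (meson \<phi>(1) gderiv_def has_derivative_continuous continuous_at_imp_continuous_on)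
  have contGb: "continuous_on W (\<lambda>x. G x \<bullet> b)" if "b \<in> Basis" for b
    using has_derivative_continuous[OF G[OF _ that]] by (auto intro!: continuous_at_imp_continuous_on)
  have int1: "integrable lborel (\<lambda>x. (G x \<bullet> b) * (\<phi>' x \<bullet> b))" if "b \<in> Basis" for b
    using \<phi>'0
    by (intro integrable_compact_support[OF K(1)] continuous_on_mult
      continuous_on_subset[OF contGb[OF that] K(2)] continuous_on_inner continuous_on_const
      continuous_on_subset[OF \<phi>(2)]) auto
  have int2: "integrable lborel (\<lambda>x. H b x b * \<phi> x)" if "b \<in> Basis" for b
    using K(3)
    by (intro integrable_compact_support[OF K(1)] continuous_on_mult
      continuous_on_subset[OF H[OF that] K(2)] continuous_on_subset[OF contphi]) auto
  have eq: "(LINT x|lborel. (G x \<bullet> b) * (\<phi>' x \<bullet> b)) = - (LINT x|lborel. H b x b * \<phi> x)"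
    if b: "b \<in> Basis" for b
  proof -
    \<comment> \<open>The product rule on \<open>W\<close>, cut to 0 outside, where nothing is known
      about \<open>G\<close> and \<open>H\<close>.\<close>
    define F where "F x h = (if x \<in> W then (G x \<bullet> b) * (h \<bullet> \<phi>' x) + H b x h * \<phi> x else 0)" for x h
    have "(LINT x|lborel. F x b) = 0"
    proof (rule integral_directional_derivative_eq_0[OF _ _ K(1)])
      show "(G x \<bullet> b) * \<phi> x = 0" if "x \<notin> K" for x using K(3) that by simp
      show "((\<lambda>x. (G x \<bullet> b) * \<phi> x) has_derivative F x) (at x)" for x
      proof (cases "x \<in> W")
        case True
        then show ?thesis
          using has_derivative_mult[OF G[OF True b] \<phi>(1)[of x, unfolded gderiv_def]]
          by (simp add: F_def[abs_def])
      next
        case False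
        then have "x \<notin> K" using K(2) by auto
        moreover have "((\<lambda>x. 0) has_derivative (\<lambda>h. 0::real)) (at x)" by simp
        ultimately have "((\<lambda>x. (G x \<bullet> b) * \<phi> x) has_derivative (\<lambda>h. 0)) (at x)"
          using has_derivative_transform_within_open
            [of "\<lambda>x. 0" "\<lambda>h. 0" x UNIV "- K" "\<lambda>x. (G x \<bullet> b) * \<phi> x"] K clK
          by (auto simp: open_Compl)
        with False show ?thesis by (simp add: F_def[abs_def])
      qed
      have "continuous_on W (\<lambda>x. (G x \<bullet> b) * (b \<bullet> \<phi>' x) + H b x b * \<phi> x)"
        by (intro continuous_on_add continuous_on_mult contGb[OF b] H[OF b] continuous_on_inner
          continuous_on_const continuous_on_subset[OF \<phi>(2)] continuous_on_subset[OF contphi]) auto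
      then have "continuous_on W (\<lambda>x. F x b)"
        by (rule continuous_on_eq) (simp add: F_def)
      then show "continuous_on UNIV (\<lambda>x. F x b)"
        using K \<phi>'0 by (intro continuous_on_UNIV_cover[OF clK W, where c = 0]) (auto simp: F_def)
    qed
    also have "(\<lambda>x. F x b) = (\<lambda>x. (G x \<bullet> b) * (\<phi>' x \<bullet> b) + H b x b * \<phi> x)"
      using nW by (auto simp: F_def fun_eq_iff inner_commute)
    also have "(LINT x|lborel. (G x \<bullet> b) * (\<phi>' x \<bullet> b) + H b x b * \<phi> x) =
      (LINT x|lborel. (G x \<bullet> b) * (\<phi>' x \<bullet> b)) + (LINT x|lborel. H b x b * \<phi> x)"
      by (rule Bochner_Integration.integral_add[OF int1[OF b] int2[OF b]])
    finally show ?thesis by simp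
  qed
  have "(LINT x|lborel. G x \<bullet> \<phi>' x) = (LINT x|lborel. (\<Sum>b\<in>Basis. (G x \<bullet> b) * (\<phi>' x \<bullet> b)))"
    by (rule Bochner_Integration.integral_cong[OF refl euclidean_inner])
  also have "\<dots> = (\<Sum>b\<in>Basis. LINT x|lborel. (G x \<bullet> b) * (\<phi>' x \<bullet> b))"
    by (rule Bochner_Integration.integral_sum[OF int1])
  also have "\<dots> = - (\<Sum>b\<in>Basis. LINT x|lborel. H b x b * \<phi> x)"
    by (simp add: eq sum_negf)
  also have "(\<Sum>b\<in>Basis. LINT x|lborel. H b x b * \<phi> x) = (LINT x|lborel. (\<Sum>b\<in>Basis. H b x b * \<phi> x))"
    by (rule Bochner_Integration.integral_sum[OF int2, symmetric])
  finally show ?thesis by (simp add: sum_distrib_right)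
qed

section \<open>Touching weak solutions by smooth functions\<close>

text \<open>Squaring removes the corner of the positive part, so truncations stay admissible as
  \<open>C1\<close> test functions. At 0 the difference quotient is \<open>max 0 h\<close>
  itself.\<close>

lemma DERIV_max_0_squared:
  "((\<lambda>t. (max 0 t)\<^sup>2) has_real_derivative 2 * max 0 t) (at (t::real))"
proof -
  consider "t > 0" | "t < 0" | "t = 0" by linarith
  then show ?thesis
  proof cases
    case 1
    have "((\<lambda>t. t\<^sup>2) has_real_derivative 2 * max 0 t) (at t)"
      using 1 by (auto intro!: derivative_eq_intros)
    then show ?thesis
      by (rule has_field_derivative_transform_within_open[of _ _ _ "{0<..}"]) (use 1 in auto)
  next
    case 2
    have "((\<lambda>t. 0) has_real_derivative 2 * max 0 t) (at t)"
      using 2 by (auto intro!: derivative_eq_intros)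
    then show ?thesis
      by (rule has_field_derivative_transform_within_open[of _ _ _ "{..<0}"]) (use 2 in auto)
  next
    case 3
    have "((\<lambda>h::real. max 0 h) \<longlongrightarrow> max 0 0) (at 0)"
      by (intro tendsto_intros)
    moreover have "(\<lambda>h::real. (max 0 h)\<^sup>2 / h) = (\<lambda>h. max 0 h)"
      by (auto simp: fun_eq_iff power2_eq_square max_def)
    ultimately show ?thesis
      using 3 by (simp add: has_field_derivative_iff)
  qed
qed

lemma AE_notin_open_imp_empty:
  fixes U :: "'a::euclidean_space set"
  assumes "open U" "AE x in lborel. x \<notin> U"
  shows "U = {}"
proof -
  have "U \<in> null_sets lborel"
    using assms by (subst AE_iff_null_sets) auto
  then have "negligible U"
    by (simp add: negligible_iff_null_sets null_sets_completionI)
  with assms(1) show ?thesis using open_not_negligible by blast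
qed

text \<open>A weak \<open>C\<^sup>1\<close> solution is a viscosity solution: at a strict maximum of \<open>z = u - \<psi>\<close> one tests
  with \<open>((z - c)\<^sup>+)\<^sup>2\<close>, which is still \<open>C\<^sup>1\<close>.\<close>
lemma weak_solution_touched_above:
  fixes u \<psi> g :: "'a::euclidean_space \<Rightarrow> real" and Gu G :: "'a \<Rightarrow> 'a"
  assumes r: "r > 0"
    and u: "\<And>x. x \<in> ball P r \<Longrightarrow> GDERIV u x :> Gu x" "continuous_on (ball P r) Gu"
    and g: "continuous_on (ball P r) g"
    and weak: "\<And>\<phi> \<phi>' K. (\<And>x. GDERIV \<phi> x :> \<phi>' x) \<Longrightarrow> continuous_on UNIV \<phi>' \<Longrightarrow> compact K \<Longrightarrow>
       K \<subseteq> ball P r \<Longrightarrow> (\<And>x. x \<notin> K \<Longrightarrow> \<phi> x = 0) \<Longrightarrow>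
       (LINT x|lborel. Gu x \<bullet> \<phi>' x) = (LINT x|lborel. g x * \<phi> x)"
    and \<psi>: "\<And>x. x \<in> ball P r \<Longrightarrow> GDERIV \<psi> x :> G x"
    and G: "\<And>x b. x \<in> ball P r \<Longrightarrow> b \<in> Basis \<Longrightarrow> ((\<lambda>x. G x \<bullet> b) has_derivative H b x) (at x)"
    and H: "\<And>b. b \<in> Basis \<Longrightarrow> continuous_on (ball P r) (\<lambda>x. H b x b)"
    and touch: "\<And>x. x \<in> ball P r \<Longrightarrow> u x - \<psi> x \<le> u P - \<psi> P"
  shows "0 \<le> g P + (\<Sum>b\<in>Basis. H b P b)"
proof (rule ccontr)
  define D where "D x = (\<Sum>b\<in>Basis. H b x b)" for x
  assume "\<not> ?thesis"
  then have neg: "g P + D P < 0" by (simp add: D_def)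
  \<comment> \<open>The perturbation \<open>\<eta> |x - P|^2\<close> adds
    \<open>2 \<eta> DIM('a)\<close> to the Laplacian. This choice uses up half of the negative
    quantity \<open>g P + D P\<close>, so \<open>E P\<close> remains negative.\<close>
  define \<eta> where "\<eta> = - (g P + D P) / (4 * real DIM('a))"
  have N: "real DIM('a) > 0" by simp
  have \<eta>: "\<eta> > 0" using neg N by (auto simp: \<eta>_def intro!: divide_pos_pos)
  have \<eta>N: "2 * \<eta> * real DIM('a) = - (g P + D P) / 2"
    using N by (simp add: \<eta>_def field_simps)
  have Pin: "P \<in> ball P r" using r by simp
  have contD: "continuous_on (ball P r) D"
    unfolding D_def by (intro continuous_intros H)
  define E where "E x = g x + D x + 2 * \<eta> * real DIM('a)" for x
  have contE: "continuous_on (ball P r) E"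
    unfolding E_def by (intro continuous_intros g contD)
  have "E P < 0" using neg \<eta>N by (simp add: E_def)
  moreover have "isCont E P"
    using contE Pin by (simp add: continuous_on_eq_continuous_at)
  ultimately have "eventually (\<lambda>x. E x < 0) (nhds P)"
    by (simp add: isCont_def order_tendstoD(2) tendsto_at_iff_tendsto_nhds)
  then obtain r1 where r1: "r1 > 0" "\<And>x. dist x P < r1 \<Longrightarrow> E x < 0"
    by (auto simp: eventually_nhds_metric)
  define r' where "r' = min r r1"
  have r': "r' > 0" "r' \<le> r" "\<And>x. x \<in> ball P r' \<Longrightarrow> E x < 0"
    using r r1 by (auto simp: r'_def dist_commute)
  define W where "W = ball P r'"
  define K where "K = cball P (r' / 2)"
  have W: "open W" "W \<subseteq> ball P r" "P \<in> W" using r' by (auto simp: W_def)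
  have K: "compact K" "closed K" "K \<subseteq> W" using r' by (auto simp: W_def K_def)
  \<comment> \<open>The quadratic term turns \<open>P\<close> into a strict maximum: at distance
    \<open>r' / 2\<close> or more from \<open>P\<close>, \<open>z\<close> has dropped to at most
    \<open>c\<close>. Hence the part of \<open>W\<close> where \<open>z > c\<close> lies in the
    compact set \<open>K\<close>.\<close>
  define z where "z x = u x - \<psi> x - \<eta> * (norm (x - P))\<^sup>2" for x
  define c where "c = z P - \<eta> * (r' / 2)\<^sup>2"
  define Gt where "Gt x = G x + (2 * \<eta>) *\<^sub>R (x - P)" for x
  define Ht where "Ht b x h = H b x h + 2 * \<eta> * (h \<bullet> b)" for b x h
  define Gz where "Gz x = Gu x - Gt x" for x
  have Gz: "GDERIV z x :> Gz x" if "x \<in> W" for x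
  proof -
    have sq: "GDERIV (\<lambda>x. \<eta> * (norm (x - P))\<^sup>2) x :> (2 * \<eta>) *\<^sub>R (x - P)"
      unfolding gderiv_def power2_norm_eq_inner
      by (auto intro!: derivative_eq_intros simp: inner_commute)
    have "x \<in> ball P r" using that W by auto
    from GDERIV_diff[OF GDERIV_diff[OF u(1)[OF this] \<psi>[OF this]] sq]
    show ?thesis by (simp add: z_def[abs_def] Gz_def Gt_def algebra_simps)
  qed
  define \<phi> where "\<phi> x = (if x \<in> W then (max 0 (z x - c))\<^sup>2 else 0)" for x
  define \<phi>' where "\<phi>' x = (if x \<in> W then (2 * max 0 (z x - c)) *\<^sub>R Gz x else 0)" for x
  have zc: "max 0 (z x - c) = 0" if "x \<in> W" "x \<notin> K" for x
  proof -
    have "u x - \<psi> x \<le> u P - \<psi> P" using touch W that by blast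
    moreover have "(r' / 2)\<^sup>2 \<le> (norm (x - P))\<^sup>2"
      using that r' by (intro power_mono) (auto simp: K_def dist_norm norm_minus_commute)
    then have "\<eta> * (r' / 2)\<^sup>2 \<le> \<eta> * (norm (x - P))\<^sup>2" using \<eta> by simp
    ultimately show ?thesis by (simp add: z_def c_def)
  qed
  have \<phi>0: "\<phi> x = 0" "\<phi>' x = 0" if "x \<notin> K" for x
    using zc that by (auto simp: \<phi>_def \<phi>'_def)
  have \<phi>_der: "GDERIV \<phi> x :> \<phi>' x" for x
  proof (cases "x \<in> W")
    case True
    have "GDERIV (\<lambda>x. z x - c) x :> Gz x"
      using GDERIV_diff[OF Gz[OF True] GDERIV_const] by simp
    from GDERIV_DERIV_compose[OF this DERIV_max_0_squared]
    have "GDERIV (\<lambda>x. (max 0 (z x - c))\<^sup>2) x :> \<phi>' x" using True by (simp add: \<phi>'_def)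
    then show ?thesis
      unfolding gderiv_def
      by (rule has_derivative_transform_within_open[OF _ W(1) True]) (simp add: \<phi>_def)
  next
    case False
    then have "x \<notin> K" using K by auto
    have "((\<lambda>x. 0) has_derivative (\<lambda>h. 0::real)) (at x)" by simp
    then have "(\<phi> has_derivative (\<lambda>h. 0)) (at x)"
      by (rule has_derivative_transform_within_open[of _ _ _ _ "- K"])
        (use K \<open>x \<notin> K\<close> \<phi>0 in auto)
    then show ?thesis using \<phi>0[OF \<open>x \<notin> K\<close>] by (simp add: gderiv_def)
  qed
  have contz: "continuous_on W z"
    using Gz by (meson gderiv_def has_derivative_continuous continuous_at_imp_continuous_on)
  have contG: "continuous_on (ball P r) G"
  proof (rule continuous_on_componentwise[THEN iffD2], rule ballI)
    fix b :: 'a assume b: "b \<in> Basis"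
    show "continuous_on (ball P r) (\<lambda>x. G x \<bullet> b)"
      using has_derivative_continuous[OF G[OF _ b]] by (auto intro!: continuous_at_imp_continuous_on)
  qed
  have contGu: "continuous_on W Gu" using u(2) W(2) by (rule continuous_on_subset)
  have contGt: "continuous_on W Gt"
    unfolding Gt_def by (intro continuous_intros continuous_on_subset[OF contG W(2)])
  have contGz: "continuous_on W Gz"
    unfolding Gz_def by (intro continuous_intros contGu contGt)
  have "continuous_on W (\<lambda>x. (2 * max 0 (z x - c)) *\<^sub>R Gz x)"
    by (intro continuous_intros contz contGz)
  then have "continuous_on W \<phi>'" by (rule continuous_on_eq) (simp add: \<phi>'_def)
  then have cont\<phi>': "continuous_on UNIV \<phi>'"
    using K W \<phi>0 by (intro continuous_on_UNIV_cover[of K W _ 0]) auto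
  have cont\<phi>: "continuous_on UNIV \<phi>"
    using \<phi>_der by (meson gderiv_def has_derivative_continuous continuous_at_imp_continuous_on)
  have eq1: "(LINT x|lborel. Gu x \<bullet> \<phi>' x) = (LINT x|lborel. g x * \<phi> x)"
    using K W by (intro weak[OF \<phi>_der cont\<phi>' K(1) _ \<phi>0(1)]) auto
  have Ht: "(\<Sum>b\<in>Basis. Ht b x b) = D x + 2 * \<eta> * real DIM('a)" for x
    by (simp add: Ht_def D_def sum.distrib inner_same_Basis)
  have eq2: "(LINT x|lborel. Gt x \<bullet> \<phi>' x) = - (LINT x|lborel. (\<Sum>b\<in>Basis. Ht b x b) * \<phi> x)"
  proof (rule integral_divergence_by_parts[where H = Ht, OF \<phi>_der cont\<phi>' K(1,3) \<phi>0(1) W(1)])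
    fix x b :: 'a assume x: "x \<in> W" and b: "b \<in> Basis"
    then have "x \<in> ball P r" using W by auto
    have "((\<lambda>x. (2 * \<eta>) * ((x - P) \<bullet> b)) has_derivative (\<lambda>h. 2 * \<eta> * (h \<bullet> b))) (at x)"
      by (auto intro!: derivative_eq_intros)
    from has_derivative_add[OF G[OF \<open>x \<in> ball P r\<close> b] this]
    show "((\<lambda>x. Gt x \<bullet> b) has_derivative Ht b x) (at x)"
      by (simp add: Gt_def[abs_def] Ht_def[abs_def] inner_add_left)
  next
    fix b :: 'a assume "b \<in> Basis"
    then show "continuous_on W (\<lambda>x. Ht b x b)"
      unfolding Ht_def by (intro continuous_intros continuous_on_subset[OF H W(2)])
  qed
  have int: "integrable lborel h" if "continuous_on W h" "\<And>x. x \<notin> K \<Longrightarrow> h x = 0" for h :: "'a \<Rightarrow> real"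
    using that K(3) by (intro integrable_compact_support[OF K(1)]) (auto intro: continuous_on_subset)
  have contW: "continuous_on W \<phi>" "continuous_on W \<phi>'" "continuous_on W g" "continuous_on W D" "continuous_on W E"
    using cont\<phi> cont\<phi>' continuous_on_subset[OF g W(2)] continuous_on_subset[OF contD W(2)]
      continuous_on_subset[OF contE W(2)]
    by (auto intro: continuous_on_subset)
  have intE: "integrable lborel (\<lambda>x. - E x * \<phi> x)"
    by (intro int continuous_intros contW) (simp add: \<phi>0)
  \<comment> \<open>The integrand is \<open>2 max 0 (z - c) |Gz|^2\<close>. The weak equation for
    \<open>u\<close> and integration by parts for the smooth part turn its integral into that of
    \<open>E \<phi>\<close>, with \<open>E\<close> negative on \<open>W\<close>. So
    \<open>\<phi>\<close> would vanish almost everywhere, although it is positive on an open set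
    around \<open>P\<close>.\<close>
  have "0 \<le> (LINT x|lborel. Gz x \<bullet> \<phi>' x)"
    by (intro Bochner_Integration.integral_nonneg) (simp add: \<phi>'_def)
  also have "\<dots> = (LINT x|lborel. Gu x \<bullet> \<phi>' x - Gt x \<bullet> \<phi>' x)"
    by (simp add: Gz_def inner_diff_left)
  also have "\<dots> = (LINT x|lborel. Gu x \<bullet> \<phi>' x) - (LINT x|lborel. Gt x \<bullet> \<phi>' x)"
    by (intro Bochner_Integration.integral_diff int continuous_intros contGu contGt contW)
      (simp_all add: \<phi>0)
  also have "\<dots> = (LINT x|lborel. g x * \<phi> x) + (LINT x|lborel. (D x + 2 * \<eta> * real DIM('a)) * \<phi> x)"
    by (simp add: eq1 eq2 Ht)
  also have "\<dots> = (LINT x|lborel. g x * \<phi> x + (D x + 2 * \<eta> * real DIM('a)) * \<phi> x)"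
    by (intro Bochner_Integration.integral_add[symmetric] int continuous_intros contW)
      (simp_all add: \<phi>0)
  also have "\<dots> = - (LINT x|lborel. - E x * \<phi> x)"
    unfolding Bochner_Integration.integral_minus[symmetric]
    by (intro Bochner_Integration.integral_cong) (auto simp: E_def algebra_simps)
  finally have le0: "(LINT x|lborel. - E x * \<phi> x) \<le> 0" by simp
  have nonneg: "- E x * \<phi> x \<ge> 0" for x
    using r'(3)[of x] by (auto simp: \<phi>_def W_def mult_nonpos_nonneg less_imp_le)
  have "(LINT x|lborel. - E x * \<phi> x) = 0"
    using le0 nonneg by (intro antisym Bochner_Integration.integral_nonneg) auto
  then have AE: "AE x in lborel. - E x * \<phi> x = 0"
    using integral_nonneg_eq_0_iff_AE[OF intE] nonneg by simp
  define U where "U = W \<inter> z -` {c<..}"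
  have "open U"
    unfolding U_def using contz W(1) by (intro continuous_open_preimage) auto
  moreover have "AE x in lborel. x \<notin> U"
  proof (rule AE_mp[OF AE], rule AE_I2, rule impI)
    fix x assume "- E x * \<phi> x = 0"
    then show "x \<notin> U" using r'(3)[of x] by (auto simp: U_def \<phi>_def W_def)
  qed
  moreover have "P \<in> U" using W(3) \<eta> r' by (simp add: U_def c_def)
  ultimately show False using AE_notin_open_imp_empty by blast
qed

text \<open>The weak equation is linear in the pair \<open>u\<close>, \<open>g\<close>, so contact
  from below follows from contact from above by negating all data. The sign \<open>\<sigma>\<close>
  lets upper and lower bounds share one statement.\<close>

lemma weak_solution_touched:
  fixes u \<psi> g :: "'a::euclidean_space \<Rightarrow> real" and Gu G :: "'a \<Rightarrow> 'a"
  assumes \<sigma>: "\<sigma> = 1 \<or> \<sigma> = -1"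
    and r: "r > 0"
    and u: "\<And>x. x \<in> ball P r \<Longrightarrow> GDERIV u x :> Gu x" "continuous_on (ball P r) Gu"
    and g: "continuous_on (ball P r) g"
    and weak: "\<And>\<phi> \<phi>' K. (\<And>x. GDERIV \<phi> x :> \<phi>' x) \<Longrightarrow> continuous_on UNIV \<phi>' \<Longrightarrow> compact K \<Longrightarrow>
       K \<subseteq> ball P r \<Longrightarrow> (\<And>x. x \<notin> K \<Longrightarrow> \<phi> x = 0) \<Longrightarrow>
       (LINT x|lborel. Gu x \<bullet> \<phi>' x) = (LINT x|lborel. g x * \<phi> x)"
    and \<psi>: "\<And>x. x \<in> ball P r \<Longrightarrow> GDERIV \<psi> x :> G x"
    and G: "\<And>x b. x \<in> ball P r \<Longrightarrow> b \<in> Basis \<Longrightarrow> ((\<lambda>x. G x \<bullet> b) has_derivative H b x) (at x)"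
    and H: "\<And>b. b \<in> Basis \<Longrightarrow> continuous_on (ball P r) (\<lambda>x. H b x b)"
    and touch: "\<And>x. x \<in> ball P r \<Longrightarrow> \<sigma> * (u x - \<psi> x) \<le> \<sigma> * (u P - \<psi> P)"
  shows "0 \<le> \<sigma> * (g P + (\<Sum>b\<in>Basis. H b P b))"
  using \<sigma>
proof
  assume "\<sigma> = 1"
  then show ?thesis
    using weak_solution_touched_above[OF r u g weak \<psi> G H] touch by simp
next
  assume \<sigma>: "\<sigma> = -1"
  have "0 \<le> - g P + (\<Sum>b\<in>Basis. - H b P b)"
  proof (rule weak_solution_touched_above[OF r, where u = "\<lambda>x. - u x" and Gu = "\<lambda>x. - Gu x"
        and g = "\<lambda>x. - g x" and \<psi> = "\<lambda>x. - \<psi> x" and G = "\<lambda>x. - G x" and H = "\<lambda>b x h. - H b x h"])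
    show "(LINT x|lborel. - Gu x \<bullet> \<phi>' x) = (LINT x|lborel. - g x * \<phi> x)"
      if "\<And>x. GDERIV \<phi> x :> \<phi>' x" "continuous_on UNIV \<phi>'" "compact K" "K \<subseteq> ball P r"
        "\<And>x. x \<notin> K \<Longrightarrow> \<phi> x = 0" for \<phi> \<phi>' K
      using weak[OF that] by simp
    show "((\<lambda>x. - G x \<bullet> b) has_derivative (\<lambda>h. - H b x h)) (at x)"
      if "x \<in> ball P r" "b \<in> Basis" for x b
      using has_derivative_minus[OF G[OF that]] by simp
    show "- u x - - \<psi> x \<le> - u P - - \<psi> P" if "x \<in> ball P r" for x
      using touch[OF that] \<sigma> by simp
  qed (use u g \<psi> H in \<open>auto intro!: GDERIV_minus continuous_intros\<close>)
  then show ?thesis using \<sigma> by (simp add: sum_negf)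
qed

section \<open>Gradient, Hessian and Laplacian of functions of ln |x|\<close>

lemma GDERIV_ln_norm:
  fixes x :: "'a::real_inner"
  assumes "x \<noteq> 0"
  shows "GDERIV (\<lambda>x. ln (norm x)) x :> (1 / (norm x)\<^sup>2) *\<^sub>R x"
proof -
  have "DERIV ln (norm x) :> inverse (norm x)"
    using assms by (auto intro!: derivative_eq_intros simp: field_simps)
  from GDERIV_DERIV_compose[OF GDERIV_norm[OF assms] this]
  show ?thesis by (simp add: sgn_div_norm power2_eq_square divide_simps)
qed

lemma GDERIV_radial:
  fixes x :: "'a::real_inner"
  assumes "x \<noteq> 0" "(h has_real_derivative h1) (at (ln (norm x)))"
  shows "GDERIV (\<lambda>x. h (ln (norm x))) x :> (h1 / (norm x)\<^sup>2) *\<^sub>R x"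
  using GDERIV_DERIV_compose[OF GDERIV_ln_norm[OF assms(1)] assms(2)] by simp

text \<open>With \<open>h1\<close> the derivative of a profile \<open>h\<close>, this is the Hessian
  of \<open>h (ln |x|)\<close>, one row for each \<open>b\<close>. It is kept as a linear map in
  \<open>y\<close> because integration by parts needs full differentiability of the gradient
  field.\<close>

lemma radial_second_derivative:
  fixes x b :: "'a::real_inner"
  assumes x: "x \<noteq> 0" and h: "(h1 has_real_derivative h2) (at (ln (norm x)))"
  shows "((\<lambda>x. ((h1 (ln (norm x)) / (norm x)\<^sup>2) *\<^sub>R x) \<bullet> b) has_derivative
    (\<lambda>y. h2 * ((y \<bullet> x) * (x \<bullet> b)) / (norm x) ^ 4
       + h1 (ln (norm x)) * ((y \<bullet> b) / (norm x)\<^sup>2 - 2 * ((y \<bullet> x) * (x \<bullet> b)) / (norm x) ^ 4))) (at x)"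
proof -
  have xx: "x \<bullet> x \<noteq> 0" using x by simp
  have n4: "norm x ^ 4 = (x \<bullet> x) * (x \<bullet> x)"
    unfolding power2_norm_eq_inner[symmetric] by (simp add: power_add[symmetric])
  have "((\<lambda>x. h1 (ln (norm x))) has_derivative (\<lambda>y. y \<bullet> (h2 / (x \<bullet> x)) *\<^sub>R x)) (at x)"
    using GDERIV_radial[OF x h] by (simp add: gderiv_def power2_norm_eq_inner)
  note D = this
  have "((\<lambda>x. x \<bullet> b) has_derivative (\<lambda>y. y \<bullet> b)) (at x)"
    "((\<lambda>x. x \<bullet> x) has_derivative (\<lambda>y. 2 * (y \<bullet> x))) (at x)"
    by (auto intro!: derivative_eq_intros simp: inner_commute)
  note has_derivative_divide'[OF has_derivative_mult[OF D this(1)] this(2) xx]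
  then have "((\<lambda>x. h1 (ln (norm x)) * (x \<bullet> b) / (x \<bullet> x)) has_derivative
     (\<lambda>y. h2 * ((y \<bullet> x) * (x \<bullet> b)) / ((x \<bullet> x) * (x \<bullet> x))
       + h1 (ln (norm x)) * ((y \<bullet> b) / (x \<bullet> x) - 2 * ((y \<bullet> x) * (x \<bullet> b)) / ((x \<bullet> x) * (x \<bullet> x))))) (at x)"
    by (rule has_derivative_eq_rhs)
      (use xx in \<open>simp add: fun_eq_iff divide_simps algebra_simps inner_commute\<close>)
  then show ?thesis by (simp only: n4 power2_norm_eq_inner inner_scaleR_left times_divide_eq_left)
qed

text \<open>The trace of that Hessian: the rank-one part has trace \<open>|x|^2\<close> and the
  identity has trace the dimension. In the variable \<open>ln |x|\<close> the Laplacian has constant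
  coefficients up to the factor \<open>1 / |x|^2\<close>.\<close>

lemma radial_laplacian:
  fixes x :: "'a::euclidean_space"
  assumes x: "x \<noteq> 0"
  shows "(\<Sum>b\<in>Basis. h2 * ((b \<bullet> x) * (x \<bullet> b)) / (norm x) ^ 4
       + h1 * ((b \<bullet> b) / (norm x)\<^sup>2 - 2 * ((b \<bullet> x) * (x \<bullet> b)) / (norm x) ^ 4))
     = (h2 + (real DIM('a) - 2) * h1) / (norm x)\<^sup>2"
proof -
  have s: "(\<Sum>b\<in>Basis. (b \<bullet> x) * (x \<bullet> b)) = (norm x)\<^sup>2"
    by (simp add: power2_norm_eq_inner euclidean_inner[of x x] inner_commute)
  have "(\<Sum>b\<in>Basis. h2 * ((b \<bullet> x) * (x \<bullet> b)) / (norm x) ^ 4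
       + h1 * ((b \<bullet> b) / (norm x)\<^sup>2 - 2 * ((b \<bullet> x) * (x \<bullet> b)) / (norm x) ^ 4))
    = (\<Sum>b\<in>Basis. (h2 - 2 * h1) / (norm x) ^ 4 * ((b \<bullet> x) * (x \<bullet> b)) + h1 / (norm x)\<^sup>2)"
    using x by (intro sum.cong refl) (simp add: inner_same_Basis field_simps)
  also have "\<dots> = (h2 - 2 * h1) / (norm x) ^ 4 * (norm x)\<^sup>2 + real DIM('a) * (h1 / (norm x)\<^sup>2)"
    by (simp only: sum.distrib sum_distrib_left[symmetric] s sum_constant)
  also have "\<dots> = (h2 + (real DIM('a) - 2) * h1) / (norm x)\<^sup>2"
    using x by (simp add: field_simps power_def eval_nat_numeral)
  finally show ?thesis .
qed

section \<open>Radial test functions\<close>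

locale hardy_solution =
  fixes \<Omega> :: "(real ^ 'n) set" and lam q \<theta> :: real and u :: "real ^ 'n \<Rightarrow> real"
  assumes q: "q > 1" and open_\<Omega>: "open \<Omega>" and zero_in: "0 \<in> \<Omega>"
    and sol: "is_solution \<Omega> lam q \<theta> u"
begin

abbreviation Th :: real where "Th \<equiv> Theta q \<theta>"
definition el :: real where "el = ell CARD('n) lam q \<theta>"

definition "a = real CARD('n) - 2 - 2 * Th"
definition "v x = norm x powr Th * u x"

lemma u_deriv: "x \<in> \<Omega> - {0} \<Longrightarrow> GDERIV u x :> grad u x"
  using sol by (auto simp: is_solution_def C1_on_def intro: GDERIV_grad)

lemma cont_grad: "continuous_on (\<Omega> - {0}) (grad u)"
  using sol by (auto simp: is_solution_def C1_on_def)

lemma cont_u: "continuous_on (\<Omega> - {0}) u"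
  using u_deriv unfolding gderiv_def
  by (meson has_derivative_continuous continuous_at_imp_continuous_on)

lemma u_pos: "x \<in> \<Omega> - {0} \<Longrightarrow> u x > 0"
  using sol by (auto simp: is_solution_def)

lemma v_pos: "x \<in> \<Omega> - {0} \<Longrightarrow> v x > 0"
  using u_pos[of x] by (simp add: v_def)

lemma cont_v: "continuous_on (\<Omega> - {0}) v"
  unfolding v_def by (intro continuous_intros cont_u) auto

text \<open>The equation is read as \<open>- Laplacian u = rhs\<close>, the shape in which the
  touching lemma takes it.\<close>

definition "rhs x = lam / (norm x)\<^sup>2 * u x - norm x powr \<theta> * u x powr q"

lemma cont_rhs: "continuous_on (\<Omega> - {0}) rhs"
  unfolding rhs_def using u_pos by (intro continuous_intros cont_u) (auto simp: less_imp_neq[symmetric])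

text \<open>Passes from set integrals over \<open>\<Omega>\<close> and the support condition of the
  definition to integrals over the whole space, with any compact \<open>K\<close> off which the test
  function vanishes.\<close>

lemma weak_equation:
  assumes \<phi>: "\<And>x. GDERIV \<phi> x :> \<phi>' x" and c: "continuous_on UNIV \<phi>'" and K: "compact K"
    "K \<subseteq> \<Omega> - {0}" "\<And>x. x \<notin> K \<Longrightarrow> \<phi> x = 0"
  shows "(LINT x|lborel. grad u x \<bullet> \<phi>' x) = (LINT x|lborel. rhs x * \<phi> x)"
proof -
  have g: "grad \<phi> = \<phi>'" using grad_eqI[OF \<phi>] by auto
  have cl: "closed K" using K(1) by (rule compact_imp_closed)
  have \<phi>'0: "\<phi>' x = 0" if "x \<notin> K" for x
    using gradient_eq_0_outside[OF cl K(3) that \<phi>] .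
  have "closure {x. \<phi> x \<noteq> 0} \<subseteq> K" using K(3) cl by (intro closure_minimal) auto
  moreover from this have "compact (closure {x. \<phi> x \<noteq> 0})"
    using K(1) by (metis closed_closure closed_Int_compact inf.absorb_iff1)
  moreover have "\<phi> differentiable (at x)" for x
    using \<phi>[of x] by (auto simp: gderiv_def differentiable_def)
  ultimately have cs: "C1_compact_support (\<Omega> - {0}) \<phi>"
    using K(2) c by (auto simp: C1_compact_support_def C1_on_def g intro: continuous_on_subset)
  have set: "(LINT x:\<Omega>|lborel. h x) = (LINT x|lborel. h x)" if "\<And>x. x \<notin> K \<Longrightarrow> h x = 0" for h :: "real^'n \<Rightarrow> real"
    unfolding set_lebesgue_integral_def
    using that K(2) by (intro Bochner_Integration.integral_cong) (auto simp: indicator_def)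
  have cont\<phi>: "continuous_on UNIV \<phi>"
    using \<phi> by (meson gderiv_def has_derivative_continuous continuous_at_imp_continuous_on)
  have contK: "continuous_on K u" "continuous_on K \<phi>"
    using cont\<phi> cont_u K(2) by (auto intro: continuous_on_subset)
  have nz: "x \<noteq> 0" "u x \<noteq> 0" if "x \<in> K" for x
    using K(2) u_pos[of x] that by (blast, force)
  \<comment> \<open>Merging the two integrals is legitimate only if both integrands are integrable.
    They are, since \<open>K\<close> is compact and avoids the origin, where the weights may be
    singular.\<close>
  have i1: "integrable lborel (\<lambda>x. lam / (norm x)\<^sup>2 * u x * \<phi> x)"
    using K(3) nz by (intro integrable_compact_support[OF K(1)] continuous_intros contK) auto
  have i2: "integrable lborel (\<lambda>x. norm x powr \<theta> * u x powr q * \<phi> x)"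
    using K(3) nz by (intro integrable_compact_support[OF K(1)] continuous_intros contK) auto
  have "(LINT x|lborel. grad u x \<bullet> \<phi>' x) = (LINT x|lborel. lam / (norm x)\<^sup>2 * u x * \<phi> x)
     - (LINT x|lborel. norm x powr \<theta> * u x powr q * \<phi> x)"
    using sol cs unfolding is_solution_def by (auto simp: g set \<phi>'0 K(3))
  also have "\<dots> = (LINT x|lborel. lam / (norm x)\<^sup>2 * u x * \<phi> x - norm x powr \<theta> * u x powr q * \<phi> x)"
    by (rule Bochner_Integration.integral_diff[OF i1 i2, symmetric])
  finally show ?thesis by (simp add: rhs_def left_diff_distrib)
qed

text \<open>The viscosity property of \<open>u\<close>, transported to \<open>v\<close> on the
  cylinder. A profile touching \<open>v\<close> becomes one touching \<open>u\<close> after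
  multiplication by \<open>|x|^(-Th)\<close>, and the resulting inequality is multiplied by
  \<open>|x|^(Th + 2)\<close>. The zero-order terms involve \<open>v P\<close> and not
  \<open>f\<close>, because contact is required only up to an additive constant.\<close>

lemma touched_by_radial:
  assumes \<sigma>: "\<sigma> = 1 \<or> \<sigma> = -1" and P: "P \<in> \<Omega> - {0}" and S: "open S" "ln (norm P) \<in> S"
    and f: "\<And>s. s \<in> S \<Longrightarrow> (f has_real_derivative f1 s) (at s)"
    and f1: "\<And>s. s \<in> S \<Longrightarrow> (f1 has_real_derivative f2 s) (at s)"
    and f2: "continuous_on S f2"
    and touch: "eventually (\<lambda>x. \<sigma> * (v x - f (ln (norm x))) \<le> \<sigma> * (v P - f (ln (norm P)))) (nhds P)"
  shows "0 \<le> \<sigma> * (f2 (ln (norm P)) + a * f1 (ln (norm P)) + el * v P - v P powr q)"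
proof -
  define s where "s = ln (norm P)"
  \<comment> \<open>The shift makes the difference vanish at \<open>P\<close>. Then an extremum is
    just a sign condition, which survives multiplication by the positive, nonconstant weight
    \<open>|x|^(-Th)\<close>.\<close>
  define m where "m = v P - f s"
  define h where "h t = exp (- Th * t) * (f t + m)" for t
  define h1 where "h1 t = exp (- Th * t) * (f1 t - Th * (f t + m))" for t
  define h2 where "h2 t = exp (- Th * t) * (f2 t - 2 * Th * f1 t + Th\<^sup>2 * (f t + m))" for t
  have h: "(h has_real_derivative h1 t) (at t)" if "t \<in> S" for t
    unfolding h_def h1_def by (rule derivative_eq_intros f[OF that] refl)+ (simp add: algebra_simps)
  have h1: "(h1 has_real_derivative h2 t) (at t)" if "t \<in> S" for t
    unfolding h1_def h2_def
    by (rule derivative_eq_intros f[OF that] f1[OF that] refl)+ (simp add: algebra_simps power2_eq_square)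
  have contS: "continuous_on S f" "continuous_on S f1"
    using f f1 by (meson DERIV_isCont continuous_at_imp_continuous_on)+
  have conth: "continuous_on S h1" "continuous_on S h2"
    unfolding h1_def h2_def by (intro continuous_intros contS f2)+
  have Pnz: "P \<noteq> 0" using P by auto
  have "eventually (\<lambda>x. x \<in> \<Omega> - {0}) (nhds P)"
    using P open_\<Omega> by (intro eventually_nhds_in_open) auto
  moreover have "eventually (\<lambda>x. ln (norm x) \<in> S) (nhds P)"
  proof -
    have "((\<lambda>x. ln (norm x)) \<longlongrightarrow> ln (norm P)) (nhds P)"
      using Pnz by (intro tendsto_intros filterlim_ident) auto
    then show ?thesis using S topological_tendstoD by blast
  qed
  ultimately have "eventually (\<lambda>x. x \<in> \<Omega> - {0} \<and> ln (norm x) \<in> S \<and>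
      \<sigma> * (v x - f (ln (norm x))) \<le> \<sigma> * (v P - f (ln (norm P)))) (nhds P)"
    using touch by eventually_elim auto
  then obtain r where r: "r > 0" and
    B: "\<And>x. x \<in> ball P r \<Longrightarrow> x \<in> \<Omega> - {0}" "\<And>x. x \<in> ball P r \<Longrightarrow> ln (norm x) \<in> S"
      "\<And>x. x \<in> ball P r \<Longrightarrow> \<sigma> * (v x - f (ln (norm x))) \<le> \<sigma> * (v P - f (ln (norm P)))"
    unfolding eventually_nhds_metric mem_ball by (metis dist_commute)
  have Bsub: "ball P r \<subseteq> \<Omega> - {0}" using B(1) by blast
  have Bnz: "x \<noteq> 0" if "x \<in> ball P r" for x using B(1)[OF that] by simp
  define H where "H b x y = h2 (ln (norm x)) * ((y \<bullet> x) * (x \<bullet> b)) / (norm x) ^ 4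
       + h1 (ln (norm x)) * ((y \<bullet> b) / (norm x)\<^sup>2 - 2 * ((y \<bullet> x) * (x \<bullet> b)) / (norm x) ^ 4)"
    for b x y :: "real ^ 'n"
  have expTh: "exp (- Th * ln (norm x)) = norm x powr (- Th)" if "x \<noteq> 0" for x :: "real^'n"
    using that by (simp add: powr_def)
  have "0 \<le> \<sigma> * (rhs P + (\<Sum>b\<in>Basis. H b P b))"
  proof (rule weak_solution_touched[OF \<sigma> r, where u = u and Gu = "grad u" and g = rhs
        and \<psi> = "\<lambda>x. h (ln (norm x))" and H = H
        and G = "\<lambda>x. (h1 (ln (norm x)) / (norm x)\<^sup>2) *\<^sub>R x"])
    show "GDERIV u x :> grad u x" if "x \<in> ball P r" for x
      using u_deriv B(1)[OF that] .
    show "continuous_on (ball P r) (grad u)" "continuous_on (ball P r) rhs"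
      using cont_grad cont_rhs Bsub by (auto intro: continuous_on_subset)
    show "(LINT x|lborel. grad u x \<bullet> \<phi>' x) = (LINT x|lborel. rhs x * \<phi> x)"
      if "\<And>x. GDERIV \<phi> x :> \<phi>' x" "continuous_on UNIV \<phi>'" "compact K" "K \<subseteq> ball P r"
        "\<And>x. x \<notin> K \<Longrightarrow> \<phi> x = 0" for \<phi> \<phi>' K
      using that Bsub by (intro weak_equation[of \<phi> \<phi>' K]) auto
    show "GDERIV (\<lambda>x. h (ln (norm x))) x :> (h1 (ln (norm x)) / (norm x)\<^sup>2) *\<^sub>R x"
      if "x \<in> ball P r" for x
      by (intro GDERIV_radial Bnz[OF that] h B(2)[OF that])
    show "((\<lambda>x. ((h1 (ln (norm x)) / (norm x)\<^sup>2) *\<^sub>R x) \<bullet> b) has_derivative H b x) (at x)"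
      if "x \<in> ball P r" for x b
      unfolding H_def by (intro radial_second_derivative Bnz[OF that] h1 B(2)[OF that])
    show "continuous_on (ball P r) (\<lambda>x. H b x b)" for b
    proof -
      have ln: "continuous_on (ball P r) (\<lambda>x. ln (norm x))"
        using Bnz by (intro continuous_intros) auto
      have "continuous_on (ball P r) (\<lambda>x. h1 (ln (norm x)))"
        "continuous_on (ball P r) (\<lambda>x. h2 (ln (norm x)))"
        using B(2) by (auto intro!: continuous_on_compose2[OF conth(1) ln] continuous_on_compose2[OF conth(2) ln])
      then show ?thesis unfolding H_def using Bnz by (intro continuous_intros) auto
    qed
    show "\<sigma> * (u x - h (ln (norm x))) \<le> \<sigma> * (u P - h (ln (norm P)))" if x: "x \<in> ball P r" for x
    proof -
      have eq: "u y - h (ln (norm y)) = norm y powr (- Th) * (v y - f (ln (norm y)) - m)" if "y \<noteq> 0" for y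
        unfolding h_def expTh[OF that] v_def
        using that by (simp add: algebra_simps powr_add[symmetric] flip: mult.assoc)
      have "\<sigma> * (v x - f (ln (norm x)) - m) \<le> 0"
        using B(3)[OF x] by (simp add: m_def s_def algebra_simps)
      then have "norm x powr (- Th) * (\<sigma> * (v x - f (ln (norm x)) - m)) \<le> 0"
        by (rule mult_nonneg_nonpos[OF powr_ge_zero])
      then have "\<sigma> * (u x - h (ln (norm x))) \<le> 0"
        unfolding eq[OF Bnz[OF x]] by (simp add: mult.left_commute)
      moreover have "u P - h (ln (norm P)) = 0" using eq[OF Pnz] by (simp add: m_def s_def)
      ultimately show ?thesis by simp
    qed
  qed
  also have "(\<Sum>b\<in>Basis. H b P b) = (h2 s + (real CARD('n) - 2) * h1 s) / (norm P)\<^sup>2"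
    unfolding H_def radial_laplacian[OF Pnz] by (simp add: s_def)
  finally have ge: "0 \<le> \<sigma> * (rhs P + (h2 s + (real CARD('n) - 2) * h1 s) / (norm P)\<^sup>2)" .
  define \<rho> where "\<rho> = norm P"
  have \<rho>: "\<rho> > 0" using Pnz by (simp add: \<rho>_def)
  have uP: "u P = \<rho> powr (- Th) * v P"
    using \<rho> by (simp add: v_def \<rho>_def powr_add[symmetric] flip: mult.assoc)
  have fm: "f s + m = v P" by (simp add: m_def)
  \<comment> \<open>The exponent \<open>Th\<close> is the one for which all powers of
    \<open>|x|\<close> in the absorption term cancel, leaving an autonomous equation.\<close>
  have Thq: "\<theta> + 2 = Th * (q - 1)" using q by (simp add: Theta_def)
  have vq: "\<rho> powr (Th + 2) * (\<rho> powr \<theta> * u P powr q) = v P powr q"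
  proof -
    have "u P powr q = \<rho> powr (- Th * q) * v P powr q"
      unfolding uP using v_pos[OF P] by (simp add: powr_mult powr_powr)
    moreover have "Th + 2 + \<theta> + - Th * q = 0" using Thq by (simp add: algebra_simps)
    then have "\<rho> powr (Th + 2) * (\<rho> powr \<theta> * \<rho> powr (- Th * q)) = 1"
      using \<rho> powr_zero_eq_one[of \<rho>] by (simp only: powr_add[symmetric] add.assoc) simp
    ultimately show ?thesis by (simp add: mult.assoc[symmetric])
  qed
  have \<rho>2: "\<rho> powr (Th + 2) = \<rho> powr Th * \<rho>\<^sup>2" using \<rho> by (simp add: powr_add powr_numeral)
  have e: "exp (- Th * s) = \<rho> powr (- Th)" using expTh[OF Pnz] by (simp add: s_def \<rho>_def)
  have one: "\<rho> powr Th * \<rho> powr (- Th) = 1" using \<rho> by (simp add: powr_add[symmetric])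
  have "\<rho> powr (Th + 2) * (lam / \<rho>\<^sup>2 * u P) = lam * v P"
    unfolding \<rho>2 uP using \<rho> one by (simp add: mult_ac)
  moreover have "\<rho> powr (Th + 2) * ((h2 s + (real CARD('n) - 2) * h1 s) / \<rho>\<^sup>2) =
     f2 s - 2 * Th * f1 s + Th\<^sup>2 * v P + (real CARD('n) - 2) * (f1 s - Th * v P)"
  proof -
    have "\<rho> powr (Th + 2) * ((h2 s + (real CARD('n) - 2) * h1 s) / \<rho>\<^sup>2) =
      \<rho> powr Th * (h2 s + (real CARD('n) - 2) * h1 s)"
      unfolding \<rho>2 using \<rho> by simp
    also have "\<dots> = (\<rho> powr Th * \<rho> powr (- Th)) *
      (f2 s - 2 * Th * f1 s + Th\<^sup>2 * v P + (real CARD('n) - 2) * (f1 s - Th * v P))"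
      unfolding h1_def h2_def e fm by (simp add: algebra_simps)
    finally show ?thesis by (simp add: one)
  qed
  ultimately have "\<rho> powr (Th + 2) * (rhs P + (h2 s + (real CARD('n) - 2) * h1 s) / (norm P)\<^sup>2)
     = f2 s + a * f1 s + el * v P - v P powr q"
    using vq unfolding rhs_def \<rho>_def[symmetric]
    by (simp add: el_def ell_def a_def algebra_simps)
  moreover have "0 \<le> \<rho> powr (Th + 2) * (\<sigma> * (rhs P + (h2 s + (real CARD('n) - 2) * h1 s) / (norm P)\<^sup>2))"
    using ge by (rule mult_nonneg_nonneg[OF powr_ge_zero])
  ultimately show ?thesis by (simp add: s_def mult.left_commute)
qed

end

section \<open>Comparison on annuli\<close>

text \<open>The annulus is compact, and the strict inequality on its boundary pushes the maximum
  inside. The conclusion \<open>F x0 \<le> F P\<close> is what carries information from the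
  uncontrolled contact point \<open>P\<close> back to the prescribed point
  \<open>x0\<close>.\<close>

lemma annulus_max_interior:
  fixes F :: "'a::euclidean_space \<Rightarrow> real"
  assumes F: "continuous_on {x. x \<noteq> 0 \<and> \<alpha> \<le> ln (norm x) \<and> ln (norm x) \<le> \<beta>} F"
    and x0: "x0 \<noteq> 0" "\<alpha> \<le> ln (norm x0)" "ln (norm x0) \<le> \<beta>"
    and bd: "\<And>x. x \<noteq> 0 \<Longrightarrow> ln (norm x) = \<alpha> \<or> ln (norm x) = \<beta> \<Longrightarrow> F x < F x0"
  obtains P where "P \<noteq> 0" "\<alpha> < ln (norm P)" "ln (norm P) < \<beta>" "F x0 \<le> F P"
    "eventually (\<lambda>x. x \<noteq> 0 \<and> \<alpha> < ln (norm x) \<and> ln (norm x) < \<beta> \<and> F x \<le> F P) (nhds P)"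
proof -
  let ?A = "{x::'a. x \<noteq> 0 \<and> \<alpha> \<le> ln (norm x) \<and> ln (norm x) \<le> \<beta>}"
  have "(\<alpha> \<le> ln (norm x)) = (exp \<alpha> \<le> norm x)" "(ln (norm x) \<le> \<beta>) = (norm x \<le> exp \<beta>)"
    if "x \<noteq> 0" for x :: 'a
    using that exp_le_cancel_iff[of \<alpha> "ln (norm x)"] exp_le_cancel_iff[of "ln (norm x)" \<beta>] by auto
  moreover have "x \<noteq> 0" if "exp \<alpha> \<le> norm x" for x :: 'a
    using that by (auto simp: not_le)
  ultimately have "?A = cball 0 (exp \<beta>) - ball 0 (exp \<alpha>)" by (fastforce simp: not_less)
  then have "compact ?A" by (simp add: compact_diff)
  then obtain P where P: "P \<in> ?A" "\<And>x. x \<in> ?A \<Longrightarrow> F x \<le> F P"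
    using continuous_attains_sup[OF _ _ F] x0 by blast
  have ge: "F x0 \<le> F P" using P(2) x0 by blast
  then have int: "\<alpha> < ln (norm P)" "ln (norm P) < \<beta>"
    using P(1) bd[of P] by force+
  have nz: "P \<noteq> 0" using P(1) by simp
  have "((\<lambda>x. ln (norm x)) \<longlongrightarrow> ln (norm P)) (nhds P)"
    using nz by (intro tendsto_intros filterlim_ident) auto
  from order_tendstoD(1)[OF this int(1)] order_tendstoD(2)[OF this int(2)] t1_space_nhds[OF nz]
  have "eventually (\<lambda>x. x \<noteq> 0 \<and> \<alpha> < ln (norm x) \<and> ln (norm x) < \<beta> \<and> F x \<le> F P) (nhds P)"
    by eventually_elim (use P(2) in auto)
  with nz int ge that show thesis by blast
qed

context hardy_solution
begin

section \<open>Upper bound from boundary blow-up\<close>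

text \<open>The barrier is \<open>M w^(-k)\<close>, with \<open>w\<close> a parabola vanishing at
  both ends of the interval of half-length \<open>R\<close>. Maximising \<open>v w^k\<close> gives
  the least \<open>M\<close> for which the barrier lies above \<open>v\<close>, and the equation at
  the contact point bounds \<open>M\<close>. The error depends only on \<open>R\<close> and the
  parameters, so it tends to 0 as \<open>R\<close> grows, uniformly in \<open>x0\<close>.\<close>

lemma upper_bound:
  defines "k \<equiv> 2 / (q - 1)"
  assumes dom: "\<And>x. x \<noteq> 0 \<Longrightarrow> ln (norm x) \<le> s0 \<Longrightarrow> x \<in> \<Omega> - {0}"
    and x0: "x0 \<noteq> 0" "ln (norm x0) + R \<le> s0" and R: "R > 0" and el: "el > 0"
  shows "v x0 powr (q - 1) \<le> el + ((4 * k * (k + 1) + 2 * k) / R\<^sup>2 + 2 * \<bar>a\<bar> * k / R)"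
proof -
  define s1 where "s1 = ln (norm x0)"
  define w where "w s = 1 - ((s - s1) / R)\<^sup>2" for s
  define w1 where "w1 s = - (2 / R\<^sup>2) * (s - s1)" for s
  have k: "k > 0" using q by (simp add: k_def)
  \<comment> \<open>With this exponent the \<open>q\<close>-th power of \<open>w^(-k)\<close> and
    its second derivative have the same singular order \<open>w^(-k - 2)\<close>.\<close>
  have kq: "k * q = k + 2" using q by (simp add: k_def field_simps)
  have w_pos: "w s > 0" if "s1 - R < s" "s < s1 + R" for s
  proof -
    have "\<bar>(s - s1) / R\<bar> < 1" using that R by (auto simp: abs_less_iff field_simps)
    then have "((s - s1) / R)\<^sup>2 < 1" by (simp add: abs_square_less_1)
    then show ?thesis by (simp add: w_def)
  qed
  have w_nonneg: "w s \<ge> 0" if "s1 - R \<le> s" "s \<le> s1 + R" for s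
  proof -
    have "\<bar>(s - s1) / R\<bar> \<le> 1" using that R by (auto simp: abs_le_iff field_simps)
    then have "((s - s1) / R)\<^sup>2 \<le> 1" by (simp add: abs_square_le_1)
    then show ?thesis by (simp add: w_def)
  qed
  have w_le: "w s \<le> 1" for s by (simp add: w_def)
  \<comment> \<open>The positive power of \<open>w\<close> keeps the function continuous up to the
    boundary, where it is 0; the barrier itself is infinite there.\<close>
  define F where "F x = v x * w (ln (norm x)) powr k" for x
  have "v x0 > 0" using v_pos dom x0 R by simp
  moreover have F0: "F x0 = v x0" using R by (simp add: F_def w_def s1_def)
  ultimately have F0pos: "F x0 > 0" by simp
  have "continuous_on {x. x \<noteq> 0 \<and> s1 - R \<le> ln (norm x) \<and> ln (norm x) \<le> s1 + R} F"
    unfolding F_def w_def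
    by (intro continuous_on_mult continuous_on_powr' continuous_on_subset[OF cont_v] continuous_intros)
      (use dom x0 R k w_nonneg in \<open>auto simp: s1_def w_def\<close>)
  moreover have "F x < F x0" if "ln (norm x) = s1 - R \<or> ln (norm x) = s1 + R" for x
    using that R F0pos k by (auto simp: F_def w_def)
  ultimately obtain P where P: "P \<noteq> 0" "s1 - R < ln (norm P)" "ln (norm P) < s1 + R" "F x0 \<le> F P"
    and ev: "eventually (\<lambda>x. x \<noteq> 0 \<and> s1 - R < ln (norm x) \<and> ln (norm x) < s1 + R \<and> F x \<le> F P) (nhds P)"
    using annulus_max_interior[of "s1 - R" "s1 + R" F x0] x0 R by (auto simp: s1_def)
  define M where "M = F P"
  have M: "M > 0" "v x0 \<le> M" using P(4) F0pos F0 by (auto simp: M_def)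
  define S where "S = {s1 - R<..<s1 + R}"
  define f where "f s = M * w s powr (- k)" for s
  define f1 where "f1 s = M * (- k) * w s powr (- k - 1) * w1 s" for s
  define f2 where "f2 s = M * k * (k + 1) * w s powr (- k - 2) * (w1 s)\<^sup>2
     + M * (2 * k / R\<^sup>2) * w s powr (- k - 1)" for s
  have wder: "(w has_real_derivative w1 s) (at s)" for s
    unfolding w_def w1_def using R
    by (auto intro!: derivative_eq_intros simp: power2_eq_square field_simps)
  have w1der: "(w1 has_real_derivative - 2 / R\<^sup>2) (at s)" for s
    unfolding w1_def by (rule derivative_eq_intros refl)+ simp
  have wS: "w s > 0" if "s \<in> S" for s using w_pos that by (simp add: S_def)
  define s where "s = ln (norm P)"
  have sS: "s \<in> S" using P by (simp add: S_def s_def)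
  have fder: "(f has_real_derivative f1 t) (at t)" if "t \<in> S" for t
    using DERIV_cmult[OF DERIV_fun_powr[OF wder wS[OF that], of "- k"], of M]
    by (simp add: f_def[abs_def] f1_def algebra_simps)
  have f1der: "(f1 has_real_derivative f2 t) (at t)" if "t \<in> S" for t
    using DERIV_cmult[OF DERIV_mult[OF DERIV_fun_powr[OF wder wS[OF that], of "- k - 1"] w1der], of "M * (- k)"]
    by (simp add: f1_def[abs_def] f2_def algebra_simps power2_eq_square)
  have f2cont: "continuous_on S f2"
    unfolding f2_def w_def w1_def
    by (intro continuous_intros) (use wS in \<open>auto simp: w_def less_imp_neq[symmetric] R less_imp_le\<close>)
  have vf: "v x - f (ln (norm x)) \<le> 0 \<longleftrightarrow> F x \<le> M" "v x - f (ln (norm x)) = 0 \<longleftrightarrow> F x = M"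
    if "ln (norm x) \<in> S" for x
    using wS[OF that] by (auto simp: F_def f_def powr_minus field_simps)
  have fP: "v P - f s = 0" using vf(2)[of P] sS by (simp add: M_def s_def)
  have "0 \<le> 1 * (f2 (ln (norm P)) + a * f1 (ln (norm P)) + el * v P - v P powr q)"
  proof (rule touched_by_radial[where S = S and f = f])
    show "P \<in> \<Omega> - {0}" using dom P x0 by (simp add: s1_def)
    show "eventually (\<lambda>x. 1 * (v x - f (ln (norm x))) \<le> 1 * (v P - f (ln (norm P)))) (nhds P)"
      using ev by eventually_elim (use vf fP in \<open>auto simp: S_def M_def s_def\<close>)
  qed (use sS fder f1der f2cont in \<open>auto simp: S_def s_def\<close>)
  then have main: "v P powr q \<le> f2 s + a * f1 s + el * v P" by (simp add: s_def)
  define y where "y = w s"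
  define Y where "Y = y powr (- k - 2)"
  have y: "y > 0" "y \<le> 1" using wS[OF sS] w_le by (auto simp: y_def)
  have Y: "Y > 0" using y by (simp add: Y_def)
  have "- k - 1 = (- k - 2) + 1" "- k = (- k - 2) + 2" by simp_all
  then have "y powr (- k - 1) = Y * y powr 1" "y powr (- k) = Y * y powr 2"
    unfolding Y_def by (metis powr_add)+
  then have Y1: "y powr (- k - 1) = Y * y" and Y2: "y powr (- k) = Y * y\<^sup>2"
    using y by (simp_all add: powr_numeral)
  have vP: "v P = M * (Y * y\<^sup>2)" using fP by (simp add: f_def y_def[symmetric] Y2)
  have "v P powr q = (M * y powr (- k)) powr q" using vP Y2 by simp
  also have "\<dots> = M powr q * y powr (- (k * q))" using M y by (simp add: powr_mult powr_powr)
  also have "\<dots> = M powr q * Y" using kq by (simp add: Y_def)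
  also have "M powr q = M * M powr (q - 1)" using M powr_add[of M 1 "q - 1"] by simp
  finally have vPq: "v P powr q = M * Y * M powr (q - 1)" by simp
  \<comment> \<open>Every term contains the factor \<open>M * Y\<close>, where \<open>Y\<close> is
    the common singular power. Once it is cancelled, only \<open>w \<le> 1\<close> and
    \<open>|w'| \<le> 2 / R\<close> are needed.\<close>
  have "M * Y * M powr (q - 1) \<le>
     M * Y * (k * (k + 1) * (w1 s)\<^sup>2 + 2 * k / R\<^sup>2 * y - a * k * y * w1 s + el * y\<^sup>2)"
    using main[unfolded vPq] unfolding f2_def f1_def y_def[symmetric] Y1 Y_def[symmetric] vP
    by (simp add: algebra_simps)
  then have "M powr (q - 1) \<le> k * (k + 1) * (w1 s)\<^sup>2 + 2 * k / R\<^sup>2 * y - a * k * y * w1 s + el * y\<^sup>2"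
    using M Y by (simp add: mult_le_cancel_left_pos)
  also have "\<dots> \<le> k * (k + 1) * (4 / R\<^sup>2) + 2 * k / R\<^sup>2 * 1 + \<bar>a\<bar> * k * (2 / R) + el * 1"
  proof -
    have w1: "\<bar>w1 s\<bar> \<le> 2 / R"
    proof -
      have "\<bar>s - s1\<bar> \<le> R" using sS by (auto simp: S_def)
      then have "2 * \<bar>s - s1\<bar> / R\<^sup>2 \<le> 2 * R / R\<^sup>2" by (intro divide_right_mono) auto
      moreover have "\<bar>w1 s\<bar> = 2 * \<bar>s - s1\<bar> / R\<^sup>2"
        unfolding w1_def abs_mult by simp
      moreover have "2 * R / R\<^sup>2 = 2 / R" using R by (simp add: power2_eq_square)
      ultimately show ?thesis by simp
    qed
    then have "(w1 s)\<^sup>2 \<le> (2 / R)\<^sup>2" by (metis abs_ge_zero power2_abs power_mono)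
    then have "k * (k + 1) * (w1 s)\<^sup>2 \<le> k * (k + 1) * (4 / R\<^sup>2)"
      using k by (intro mult_left_mono) (auto simp: power_divide)
    moreover have "2 * k / R\<^sup>2 * y \<le> 2 * k / R\<^sup>2 * 1" using k y by (intro mult_left_mono) auto
    moreover have "el * y\<^sup>2 \<le> el * 1" using el y by (intro mult_left_mono) (auto simp: power_le_one)
    moreover have "- (a * k * y * w1 s) \<le> \<bar>a\<bar> * k * (2 / R)"
    proof -
      have "- (a * k * y * w1 s) \<le> \<bar>a\<bar> * k * (y * \<bar>w1 s\<bar>)"
        using k y abs_ge_minus_self[of "a * k * y * w1 s"] by (simp add: abs_mult mult.assoc)
      also have "\<dots> \<le> \<bar>a\<bar> * k * (1 * (2 / R))"
        using y k w1 by (intro mult_left_mono mult_mono) auto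
      finally show ?thesis by simp
    qed
    ultimately show ?thesis by linarith
  qed
  finally have "M powr (q - 1) \<le> el + ((4 * k * (k + 1) + 2 * k) / R\<^sup>2 + 2 * \<bar>a\<bar> * k / R)"
    by (simp add: add_divide_distrib mult_ac)
  moreover have "v x0 powr (q - 1) \<le> M powr (q - 1)"
    using M q F0pos F0 by (intro powr_mono2) auto
  ultimately show ?thesis by linarith
qed

section \<open>Lower bounds: positivity in each case, then improvement to the equilibrium\<close>

text \<open>The profile \<open>f = c (1 - e^(a (s1 - s)))\<close> satisfies
  \<open>f'' + a f' = 0\<close>, so contact from below would force \<open>v^(q-1) \<ge> el\<close>,
  whereas there \<open>v < f < c\<close>. Since \<open>a > 0\<close>, \<open>f\<close> rises from 0
  at \<open>s1\<close> and never exceeds \<open>c\<close>; the inner boundary therefore needs only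
  \<open>v > 0\<close>, and the bound does not degenerate towards the origin.\<close>

lemma lower_bound_damped:
  assumes dom: "\<And>x. x \<noteq> 0 \<Longrightarrow> ln (norm x) \<le> s0 \<Longrightarrow> x \<in> \<Omega> - {0}"
    and a: "a > 0" and el: "el > 0"
  obtains c where "c > 0" "\<And>x. x \<noteq> 0 \<Longrightarrow> ln (norm x) \<le> s0 \<Longrightarrow> c \<le> v x"
proof -
  have sph: "x \<noteq> 0 \<and> ln (norm x) = s0" if "x \<in> sphere 0 (exp s0)" for x :: "real ^ 'n"
    using that by (auto simp: dest: sym)
  obtain c0 where c0: "c0 > 0" "\<And>x. x \<in> sphere 0 (exp s0) \<Longrightarrow> c0 \<le> v x"
  proof (cases "sphere (0 :: real ^ 'n) (exp s0) = {}")
    case True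
    then show ?thesis using that[of 1] by simp
  next
    case False
    have "sphere 0 (exp s0) \<subseteq> \<Omega> - {0}" using dom sph by blast
    then obtain p where "p \<in> sphere 0 (exp s0)" "\<And>x. x \<in> sphere 0 (exp s0) \<Longrightarrow> v p \<le> v x"
      using continuous_attains_inf[OF compact_sphere False continuous_on_subset[OF cont_v]] by blast
    then show ?thesis using that[of "v p"] v_pos[of p] \<open>sphere 0 (exp s0) \<subseteq> _\<close> by blast
  qed
  \<comment> \<open>The first bound handles the outer sphere, the second gives
    \<open>c^(q-1) < el\<close> for the contradiction at the contact point.\<close>
  define c where "c = min c0 ((el / 2) powr (1 / (q - 1)))"
  have c: "c > 0" "c \<le> c0" using c0 el by (auto simp: c_def)
  have "c powr (q - 1) \<le> ((el / 2) powr (1 / (q - 1))) powr (q - 1)"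
    using q c by (intro powr_mono2) (auto simp: c_def)
  also have "\<dots> = el / 2" using q el by (simp add: powr_powr)
  finally have cq: "c powr (q - 1) < el" using el by simp
  have "c / 2 \<le> v x0" if x0: "x0 \<noteq> 0" "ln (norm x0) \<le> s0" for x0
  proof (rule ccontr)
    assume "\<not> c / 2 \<le> v x0"
    then have v0: "v x0 < c / 2" by simp
    \<comment> \<open>Placed so that the exponential equals \<open>1/2\<close> at \<open>x0\<close>,
      hence \<open>f = c / 2\<close> there.\<close>
    define s1 where "s1 = ln (norm x0) - ln 2 / a"
    have s1: "s1 < ln (norm x0)" using a by (simp add: s1_def)
    define f where "f t = c * (1 - exp (a * (s1 - t)))" for t
    define f1 where "f1 t = c * a * exp (a * (s1 - t))" for t
    define f2 where "f2 t = - c * a\<^sup>2 * exp (a * (s1 - t))" for t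
    have "exp (a * (s1 - ln (norm x0))) = 1 / 2"
      using a by (simp add: s1_def exp_minus)
    then have f0: "f (ln (norm x0)) = c / 2" by (simp add: f_def)
    define F where "F x = f (ln (norm x)) - v x" for x
    have F0: "F x0 > 0" using v0 f0 by (simp add: F_def)
    have fc: "f t < c" for t using c by (simp add: f_def)
    have "continuous_on {x. x \<noteq> 0 \<and> s1 \<le> ln (norm x) \<and> ln (norm x) \<le> s0} F"
      unfolding F_def f_def
      by (intro continuous_intros continuous_on_subset[OF cont_v]) (use dom in auto)
    moreover have "F x < F x0" if "x \<noteq> 0" "ln (norm x) = s1 \<or> ln (norm x) = s0" for x
    proof -
      have "F x \<le> 0"
      proof (cases "ln (norm x) = s0")
        case True
        then have "norm x = exp s0" using that by (metis exp_ln zero_less_norm_iff)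
        then have "c \<le> v x" using c0(2)[of x] c by simp
        then show ?thesis using fc[of "ln (norm x)"] by (simp add: F_def)
      next
        case False
        then have "ln (norm x) = s1" using that by simp
        moreover have "v x > 0" using dom[of x] that s1 x0 by (intro v_pos) auto
        ultimately show ?thesis by (simp add: F_def f_def)
      qed
      then show ?thesis using F0 by simp
    qed
    ultimately obtain P where P: "P \<noteq> 0" "s1 < ln (norm P)" "ln (norm P) < s0" "F x0 \<le> F P"
      and ev: "eventually (\<lambda>x. x \<noteq> 0 \<and> s1 < ln (norm x) \<and> ln (norm x) < s0 \<and> F x \<le> F P) (nhds P)"
      using annulus_max_interior[of s1 s0 F x0] x0 s1 by auto
    have Pin: "P \<in> \<Omega> - {0}" using dom P by simp
    have "0 \<le> - 1 * (f2 (ln (norm P)) + a * f1 (ln (norm P)) + el * v P - v P powr q)"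
    proof (rule touched_by_radial[where S = UNIV and f = f, OF _ Pin])
      show "eventually (\<lambda>x. - 1 * (v x - f (ln (norm x))) \<le> - 1 * (v P - f (ln (norm P)))) (nhds P)"
        using ev by eventually_elim (auto simp: F_def)
      show "(f has_real_derivative f1 t) (at t)" for t
        unfolding f_def f1_def by (auto intro!: derivative_eq_intros)
      show "(f1 has_real_derivative f2 t) (at t)" for t
        unfolding f1_def f2_def by (auto intro!: derivative_eq_intros simp: power2_eq_square)
      show "continuous_on UNIV f2" unfolding f2_def by (intro continuous_intros)
    qed auto
    then have le: "el * v P \<le> v P powr q" by (simp add: f1_def f2_def power2_eq_square)
    have vP: "v P > 0" using v_pos[OF Pin] .
    have "v P powr q = v P * v P powr (q - 1)" using vP powr_add[of "v P" 1 "q - 1"] by simp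
    with le vP have "el \<le> v P powr (q - 1)" by (simp add: mult.commute)
    also have "v P < c" using P(4) F0 fc[of "ln (norm P)"] by (simp add: F_def)
    then have "v P powr (q - 1) \<le> c powr (q - 1)" using vP q by (intro powr_mono2) auto
    finally show False using cq by simp
  qed
  with that[of "c / 2"] c show thesis by simp
qed

text \<open>For \<open>el > a^2 / 4\<close> the linearised equation at 0 has complex characteristic
  roots, so a positive arch of fixed length exists. Enlarging the arch until it touches
  \<open>v\<close> forces \<open>v\<close> to be bounded below at the contact point, and the ratio
  of arch to \<open>v\<close> transfers this to the centre \<open>x0\<close>.\<close>

lemma lower_bound_oscillating:
  assumes dom: "\<And>x. x \<noteq> 0 \<Longrightarrow> ln (norm x) \<le> s0 \<Longrightarrow> x \<in> \<Omega> - {0}"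
    and el: "el > a\<^sup>2 / 4"
  obtains c T where "c > 0" "T \<le> s0" "\<And>x. x \<noteq> 0 \<Longrightarrow> ln (norm x) \<le> T \<Longrightarrow> c \<le> v x"
proof -
  \<comment> \<open>Only half of the gap goes into the frequency. The other half survives at the
    contact point as the inequality \<open>om^2 v \<le> v^q\<close>, which yields
    \<open>v \<ge> d\<close>.\<close>
  define om where "om = sqrt ((el - a\<^sup>2 / 4) / 2)"
  have om: "om > 0" "om\<^sup>2 = (el - a\<^sup>2 / 4) / 2" using el by (auto simp: om_def)
  \<comment> \<open>A quarter period, so the cosine vanishes exactly at \<open>s1 - R\<close> and
    \<open>s1 + R\<close>.\<close>
  define R where "R = pi / (2 * om)"
  have R: "R > 0" using om by (simp add: R_def)
  have omR: "om * R = pi / 2" using om by (simp add: R_def)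
  define d where "d = (om\<^sup>2) powr (1 / (q - 1))"
  define B where "B = exp (\<bar>a\<bar> / 2 * R)"
  have d: "d > 0" using om(1) by (simp add: d_def)
  have "d / B \<le> v x0" if x0: "x0 \<noteq> 0" "ln (norm x0) \<le> s0 - R" for x0
  proof -
    define s1 where "s1 = ln (norm x0)"
    define b where "b t = exp (- (a / 2) * (t - s1)) * cos (om * (t - s1))" for t
    define b1 where "b1 t = - (a / 2) * b t - om * (exp (- (a / 2) * (t - s1)) * sin (om * (t - s1)))" for t
    \<comment> \<open>The second derivative is written through the equation
      \<open>b'' + a b' + (a^2/4 + om^2) b = 0\<close>, so that the later use is a substitution;
      \<open>b1der\<close> checks it.\<close>
    define b2 where "b2 t = - (a\<^sup>2 / 4 + om\<^sup>2) * b t - a * b1 t" for t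
    have bder: "(b has_real_derivative b1 t) (at t)" for t
      unfolding b_def b1_def by (rule derivative_eq_intros refl)+ (simp add: algebra_simps)
    have b1der: "(b1 has_real_derivative b2 t) (at t)" for t
    proof -
      have "((\<lambda>t. exp (- (a / 2) * (t - s1)) * sin (om * (t - s1))) has_real_derivative
        - (a / 2) * (exp (- (a / 2) * (t - s1)) * sin (om * (t - s1))) + om * b t) (at t)"
        unfolding b_def by (rule derivative_eq_intros refl)+ (simp add: algebra_simps)
      from DERIV_diff[OF DERIV_cmult[OF bder, of "- (a / 2)"] DERIV_cmult[OF this, of om]]
      have "(b1 has_real_derivative - (a / 2) * b1 t - om * (- (a / 2) *
         (exp (- (a / 2) * (t - s1)) * sin (om * (t - s1))) + om * b t)) (at t)"
        by (simp add: b1_def[abs_def])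
      moreover have "- (a / 2) * b1 t - om * (- (a / 2) *
         (exp (- (a / 2) * (t - s1)) * sin (om * (t - s1))) + om * b t) = b2 t"
        by (simp add: b2_def b1_def algebra_simps power2_eq_square)
      ultimately show ?thesis by simp
    qed
    \<comment> \<open>If \<open>M\<close> is the maximum of this ratio, \<open>b / M\<close> lies
      below \<open>v\<close> and touches it at the maximum point.\<close>
    define F where "F x = b (ln (norm x)) / v x" for x
    have "v x0 > 0" using v_pos dom x0 R by simp
    moreover have F0: "F x0 = 1 / v x0" by (simp add: F_def b_def s1_def)
    ultimately have F0pos: "F x0 > 0" by simp
    have vpos: "v x > 0" if "x \<noteq> 0" "ln (norm x) \<le> s1 + R" for x
      using that x0 by (intro v_pos dom) (auto simp: s1_def)
    have "continuous_on {x. x \<noteq> 0 \<and> s1 - R \<le> ln (norm x) \<and> ln (norm x) \<le> s1 + R} F"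
      unfolding F_def b_def
      by (intro continuous_intros continuous_on_subset[OF cont_v])
        (use dom x0 in \<open>auto simp: s1_def less_imp_neq[OF vpos, symmetric]\<close>)
    moreover have "F x < F x0" if "ln (norm x) = s1 - R \<or> ln (norm x) = s1 + R" for x
    proof -
      have "b (ln (norm x)) = 0" using that by (auto simp: b_def omR)
      then show ?thesis using F0pos by (simp add: F_def)
    qed
    ultimately obtain P where P: "P \<noteq> 0" "s1 - R < ln (norm P)" "ln (norm P) < s1 + R" "F x0 \<le> F P"
      and ev: "eventually (\<lambda>x. x \<noteq> 0 \<and> s1 - R < ln (norm x) \<and> ln (norm x) < s1 + R \<and> F x \<le> F P) (nhds P)"
      using annulus_max_interior[of "s1 - R" "s1 + R" F x0] x0 R by (auto simp: s1_def)
    define s where "s = ln (norm P)"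
    define M where "M = F P"
    have M: "M > 0" using P(4) F0pos by (simp add: M_def)
    have Pin: "P \<in> \<Omega> - {0}" using dom P x0 by (simp add: s1_def)
    have vP: "v P > 0" using v_pos[OF Pin] .
    have bP: "b s = M * v P" using vP by (simp add: M_def F_def s_def)
    have "0 \<le> - 1 * ((\<lambda>t. b2 t / M) (ln (norm P)) + a * (\<lambda>t. b1 t / M) (ln (norm P)) + el * v P - v P powr q)"
    proof (rule touched_by_radial[where S = UNIV and f = "\<lambda>t. b t / M", OF _ Pin])
      show "eventually (\<lambda>x. - 1 * (v x - b (ln (norm x)) / M) \<le> - 1 * (v P - b (ln (norm P)) / M)) (nhds P)"
        using ev
      proof eventually_elim
        case (elim x)
        then have "v x > 0" using vpos by simp
        moreover have "F x \<le> M" using elim by (simp add: M_def)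
        ultimately have "b (ln (norm x)) / M \<le> v x"
          using M by (simp add: F_def field_simps)
        moreover have "b (ln (norm P)) / M = v P" using bP M by (simp add: s_def)
        ultimately show ?case by simp
      qed
      show "((\<lambda>t. b t / M) has_real_derivative b1 t / M) (at t)"
        "((\<lambda>t. b1 t / M) has_real_derivative b2 t / M) (at t)" for t
        by (intro DERIV_cdivide bder b1der)+
      show "continuous_on UNIV (\<lambda>t. b2 t / M)"
        unfolding b2_def b1_def b_def by (intro continuous_intros) (use M in auto)
    qed auto
    moreover have "b2 s / M + a * (b1 s / M) = - (a\<^sup>2 / 4 + om\<^sup>2) * v P"
      using M bP by (simp add: b2_def field_simps)
    ultimately have "(el - (a\<^sup>2 / 4 + om\<^sup>2)) * v P \<le> v P powr q"
      by (simp add: s_def algebra_simps)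
    moreover have "el - (a\<^sup>2 / 4 + om\<^sup>2) = om\<^sup>2" using om(2) by simp
    moreover have "v P powr q = v P powr (q - 1) * v P" using vP powr_add[of "v P" "q - 1" 1] by simp
    ultimately have "om\<^sup>2 \<le> v P powr (q - 1)" using vP by simp
    then have "d \<le> (v P powr (q - 1)) powr (1 / (q - 1))"
      unfolding d_def using q by (intro powr_mono2) auto
    also have "\<dots> = v P" using q vP by (simp add: powr_powr)
    finally have dv: "d \<le> v P" .
    have "b s \<le> exp (- (a / 2) * (s - s1)) * 1"
      unfolding b_def by (intro mult_left_mono) auto
    also have "\<dots> \<le> B"
    proof -
      have "- (a / 2) * (s - s1) \<le> \<bar>- (a / 2) * (s - s1)\<bar>" by (rule abs_ge_self)
      also have "\<dots> = \<bar>a\<bar> / 2 * \<bar>s - s1\<bar>" by (simp add: abs_mult)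
      also have "\<dots> \<le> \<bar>a\<bar> / 2 * R" using P by (intro mult_left_mono) (auto simp: s_def)
      finally show ?thesis by (simp add: B_def)
    qed
    finally have bB: "b s \<le> B" .
    have "1 / v x0 \<le> b s / v P" using P(4) unfolding F0 by (simp add: F_def s_def)
    also have "\<dots> \<le> B / d" using bB dv d vP by (intro frac_le) (auto simp: B_def)
    finally show "d / B \<le> v x0"
      using \<open>v x0 > 0\<close> d by (simp add: B_def field_simps)
  qed
  then show thesis using that[of "d / B" "s0 - R"] d R by (simp add: B_def)
qed

text \<open>If \<open>v\<close> were below \<open>A\<close> at the centre, a parabola of height
  \<open>A\<close> there and \<open>c\<close> at the ends would, after a shift, touch
  \<open>v\<close> from below at a point where \<open>c \<le> v < A\<close>. There the reaction term
  \<open>v (el - v^(q-1))\<close> is at least \<open>\<delta>\<close>, while the derivatives of a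
  parabola of half-width \<open>R\<close> contribute only a multiple of
  \<open>1 / R\<close>.\<close>

lemma lower_bound_improve:
  assumes dom: "\<And>x. x \<noteq> 0 \<Longrightarrow> ln (norm x) \<le> T \<Longrightarrow> x \<in> \<Omega> - {0}"
    and c: "c > 0" "\<And>x. x \<noteq> 0 \<Longrightarrow> ln (norm x) \<le> T \<Longrightarrow> c \<le> v x"
    and A: "c < A" "A powr (q - 1) < el"
  obtains T' where "\<And>x. x \<noteq> 0 \<Longrightarrow> ln (norm x) \<le> T' \<Longrightarrow> A \<le> v x"
proof -
  define \<delta> where "\<delta> = c * (el - A powr (q - 1))"
  have \<delta>: "\<delta> > 0" using c A by (simp add: \<delta>_def)
  \<comment> \<open>Large enough for the derivative terms to fall below \<open>\<delta>\<close>, and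
    at least 1 so that \<open>1 / R^2\<close> may be replaced by \<open>1 / R\<close>.\<close>
  define R where "R = 1 + 2 * (A - c) * (1 + \<bar>a\<bar>) / \<delta>"
  have R: "R \<ge> 1" using \<delta> A by (simp add: R_def)
  have "2 * (A - c) * (1 + \<bar>a\<bar>) / \<delta> < R" by (simp add: R_def)
  then have R\<delta>: "2 * (A - c) * (1 + \<bar>a\<bar>) / R < \<delta>" using \<delta> R by (simp add: field_simps)
  have "A \<le> v x0" if x0: "x0 \<noteq> 0" "ln (norm x0) \<le> T - R" for x0
  proof (rule ccontr)
    assume "\<not> A \<le> v x0"
    then have v0: "v x0 < A" by simp
    define s1 where "s1 = ln (norm x0)"
    define f where "f t = A - (A - c) * ((t - s1) / R)\<^sup>2" for t
    define f1 where "f1 t = - (2 * (A - c) / R\<^sup>2) * (t - s1)" for t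
    define f2 where "f2 t = - (2 * (A - c) / R\<^sup>2)" for t :: real
    define F where "F x = f (ln (norm x)) - v x" for x
    have F0: "F x0 > 0" using v0 by (simp add: F_def f_def s1_def)
    have "continuous_on {x. x \<noteq> 0 \<and> s1 - R \<le> ln (norm x) \<and> ln (norm x) \<le> s1 + R} F"
      unfolding F_def f_def
      by (intro continuous_intros continuous_on_subset[OF cont_v]) (use dom x0 R in \<open>auto simp: s1_def\<close>)
    moreover have "F x < F x0" if "x \<noteq> 0" "ln (norm x) = s1 - R \<or> ln (norm x) = s1 + R" for x
    proof -
      have "f (ln (norm x)) = c" using that(2) R by (auto simp: f_def)
      moreover have "c \<le> v x" using that x0 R by (intro c) (auto simp: s1_def)
      ultimately show ?thesis using F0 by (simp add: F_def)
    qed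
    ultimately obtain P where P: "P \<noteq> 0" "s1 - R < ln (norm P)" "ln (norm P) < s1 + R" "F x0 \<le> F P"
      and ev: "eventually (\<lambda>x. x \<noteq> 0 \<and> s1 - R < ln (norm x) \<and> ln (norm x) < s1 + R \<and> F x \<le> F P) (nhds P)"
      using annulus_max_interior[of "s1 - R" "s1 + R" F x0] x0 R by (auto simp: s1_def)
    define s where "s = ln (norm P)"
    have Pin: "P \<in> \<Omega> - {0}" using dom P x0 by (simp add: s1_def)
    have "0 \<le> - 1 * (f2 (ln (norm P)) + a * f1 (ln (norm P)) + el * v P - v P powr q)"
    proof (rule touched_by_radial[where S = UNIV and f = f, OF _ Pin])
      show "eventually (\<lambda>x. - 1 * (v x - f (ln (norm x))) \<le> - 1 * (v P - f (ln (norm P)))) (nhds P)"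
        using ev by eventually_elim (auto simp: F_def)
      show "(f has_real_derivative f1 t) (at t)" for t
        unfolding f_def f1_def using R
        by (auto intro!: derivative_eq_intros simp: power2_eq_square field_simps)
      show "(f1 has_real_derivative f2 t) (at t)" for t
        unfolding f1_def f2_def by (rule derivative_eq_intros refl)+ simp
      show "continuous_on UNIV f2" unfolding f2_def by (intro continuous_intros) (use R in auto)
    qed auto
    then have le: "el * v P - v P powr q \<le> - f2 s - a * f1 s" by (simp add: s_def)
    have vP: "c \<le> v P" using P x0 by (intro c) (auto simp: s1_def)
    have "f s \<le> A" using A by (simp add: f_def)
    then have vA: "v P < A" using P(4) F0 by (simp add: F_def s_def)
    have "v P powr q = v P * v P powr (q - 1)" using vP c powr_add[of "v P" 1 "q - 1"] by simp
    moreover have "v P powr (q - 1) \<le> A powr (q - 1)" using vP c vA q by (intro powr_mono2) auto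
    then have "c * (el - A powr (q - 1)) \<le> v P * (el - v P powr (q - 1))"
      using vP c A by (intro mult_mono) auto
    ultimately have "\<delta> \<le> - f2 s - a * f1 s" using le by (simp add: \<delta>_def algebra_simps)
    also have "\<dots> \<le> 2 * (A - c) / R + \<bar>a\<bar> * (2 * (A - c) / R)"
    proof -
      have "R * 1 \<le> R\<^sup>2" using R unfolding power2_eq_square by (intro mult_left_mono) auto
      then have "- f2 s \<le> 2 * (A - c) / R"
        unfolding f2_def using A R by (simp add: frac_le)
      moreover have "\<bar>f1 s\<bar> \<le> 2 * (A - c) / R"
      proof -
        have "\<bar>s - s1\<bar> \<le> R" using P by (auto simp: s_def)
        then have "2 * (A - c) * \<bar>s - s1\<bar> / R\<^sup>2 \<le> 2 * (A - c) * R / R\<^sup>2"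
          using A by (intro divide_right_mono mult_left_mono) auto
        moreover have "\<bar>f1 s\<bar> = 2 * (A - c) * \<bar>s - s1\<bar> / R\<^sup>2"
          using A unfolding f1_def abs_mult by simp
        moreover have "2 * (A - c) * R / R\<^sup>2 = 2 * (A - c) / R" using R by (simp add: power2_eq_square)
        ultimately show ?thesis by simp
      qed
      then have "\<bar>a\<bar> * \<bar>f1 s\<bar> \<le> \<bar>a\<bar> * (2 * (A - c) / R)" by (intro mult_left_mono) auto
      moreover have "- (a * f1 s) \<le> \<bar>a\<bar> * \<bar>f1 s\<bar>" by (metis abs_ge_minus_self abs_mult)
      ultimately show ?thesis by linarith
    qed
    also have "\<dots> = 2 * (A - c) * (1 + \<bar>a\<bar>) / R" using R by (simp add: divide_simps algebra_simps)
    finally show False using R\<delta> by simp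
  qed
  then show thesis by (rule that)
qed

end

section \<open>The limit at the origin\<close>

lemma eventually_at_0_ln_norm:
  fixes Q :: "'a::real_normed_vector \<Rightarrow> bool"
  assumes "\<And>x. x \<noteq> 0 \<Longrightarrow> ln (norm x) \<le> T \<Longrightarrow> Q x"
  shows "eventually Q (at 0)"
  unfolding eventually_at
proof (intro exI conjI ballI impI)
  fix x :: 'a assume "x \<noteq> 0 \<and> dist x 0 < exp T"
  then show "Q x" using ln_less_cancel_iff[of "norm x" "exp T"] by (intro assms) auto
qed auto

context hardy_solution
begin

lemma log_domain: obtains s0 where "\<And>x. x \<noteq> 0 \<Longrightarrow> ln (norm x) \<le> s0 \<Longrightarrow> x \<in> \<Omega> - {0}"
proof -
  obtain e where e: "e > 0" "cball 0 e \<subseteq> \<Omega>" using open_\<Omega> zero_in open_contains_cball by blast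
  have "x \<in> \<Omega> - {0}" if "x \<noteq> 0" "ln (norm x) \<le> ln e" for x
    using that e ln_le_cancel_iff[of "norm x" e] by auto
  then show thesis by (rule that)
qed

text \<open>Here both cases merge: any positive lower bound near the origin can be raised to any
  level below the equilibrium, and the upper bound approaches the equilibrium as \<open>R\<close>
  grows.\<close>

lemma v_tendsto:
  assumes el: "el > 0"
    and low: "c > 0" "\<And>x. x \<noteq> 0 \<Longrightarrow> ln (norm x) \<le> T \<Longrightarrow> c \<le> v x"
  shows "(v \<longlongrightarrow> el powr (1 / (q - 1))) (at 0)"
proof -
  obtain s0 where dom: "\<And>x. x \<noteq> 0 \<Longrightarrow> ln (norm x) \<le> s0 \<Longrightarrow> x \<in> \<Omega> - {0}"
    using log_domain by blast
  define V where "V = el powr (1 / (q - 1))"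
  have V: "V > 0" "V powr (q - 1) = el" using el q by (auto simp: V_def powr_powr)
  have "(v \<longlongrightarrow> V) (at 0)"
  proof (rule order_tendstoI)
    fix y assume y: "y < V"
    \<comment> \<open>A level strictly between \<open>y\<close> and \<open>V\<close> that is
      positive even when \<open>y\<close> is not.\<close>
    define A where "A = (max y (V / 2) + V) / 2"
    have A: "y < A" "A > 0" "A < V" using y V by (auto simp: A_def max_def)
    have "A powr (q - 1) < V powr (q - 1)" using A q by (intro powr_less_mono2) auto
    then have Aq: "A powr (q - 1) < el" using V by simp
    \<comment> \<open>The improvement starts from a bound strictly below the target, so
      \<open>c\<close> may have to be lowered.\<close>
    define c' where "c' = min c (A / 2)"
    obtain T' where "\<And>x. x \<noteq> 0 \<Longrightarrow> ln (norm x) \<le> T' \<Longrightarrow> A \<le> v x"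
    proof (rule lower_bound_improve[of "min s0 T" c' A])
      show "c' \<le> v x" if "x \<noteq> 0" "ln (norm x) \<le> min s0 T" for x
        using low(2)[of x] that by (simp add: c'_def)
    qed (use dom A Aq low in \<open>auto simp: c'_def\<close>)
    then show "eventually (\<lambda>x. y < v x) (at 0)"
      using A by (intro eventually_at_0_ln_norm[of T']) force
  next
    fix y assume y: "V < y"
    define k where "k = 2 / (q - 1)"
    have k: "k > 0" using q by (simp add: k_def)
    \<comment> \<open>Collects the coefficients of the upper bound, whose error is at most
      \<open>C / R\<close> once \<open>R \<ge> 1\<close>.\<close>
    define C where "C = 4 * k * (k + 1) + 2 * k + 2 * \<bar>a\<bar> * k"
    have C: "C > 0" using k by (auto simp: C_def intro!: add_pos_nonneg)
    have "V powr (q - 1) < y powr (q - 1)" using y V q by (intro powr_less_mono2) auto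
    then have gap: "y powr (q - 1) - el > 0" using V by simp
    define R where "R = 1 + C / (y powr (q - 1) - el)"
    have R: "R \<ge> 1" using C gap by (simp add: R_def)
    have "C / (y powr (q - 1) - el) < R" by (simp add: R_def)
    then have CR: "C / R < y powr (q - 1) - el" using gap R by (simp add: field_simps)
    show "eventually (\<lambda>x. v x < y) (at 0)"
    proof (rule eventually_at_0_ln_norm[of "s0 - R"])
      fix x :: "real ^ 'n" assume x: "x \<noteq> 0" "ln (norm x) \<le> s0 - R"
      have "v x powr (q - 1) \<le> el + ((4 * k * (k + 1) + 2 * k) / R\<^sup>2 + 2 * \<bar>a\<bar> * k / R)"
        unfolding k_def using x R el by (intro upper_bound[OF dom]) auto
      also have "(4 * k * (k + 1) + 2 * k) / R\<^sup>2 \<le> (4 * k * (k + 1) + 2 * k) / R"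
      proof (rule divide_left_mono)
        show "R \<le> R\<^sup>2" using R mult_left_mono[of 1 R R] by (simp add: power2_eq_square)
      qed (use k R in auto)
      then have "el + ((4 * k * (k + 1) + 2 * k) / R\<^sup>2 + 2 * \<bar>a\<bar> * k / R) \<le> el + C / R"
        by (simp add: C_def add_divide_distrib)
      also have "\<dots> < y powr (q - 1)" using CR by simp
      finally have "v x powr (q - 1) < y powr (q - 1)" .
      then show "v x < y"
        using powr_mono2[of "q - 1" y "v x"] y V q by force
    qed
  qed
  then show ?thesis by (simp add: V_def)
qed

end

theorem theorem1p2:
  fixes \<Omega>0 :: "(real ^ 'n) set" and q lam \<theta> :: real and u :: "real ^ 'n \<Rightarrow> real"
  assumes "CARD('n) \<ge> 3"
    and "q > 1"
    and "open \<Omega>0" and "0 \<in> \<Omega>0"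
    and "lam > lambda_H CARD('n) \<or>
         (lam \<le> lambda_H CARD('n) \<and> \<theta> < theta_minus CARD('n) lam q)"
    and "is_solution \<Omega>0 lam q \<theta> u"
  shows "((\<lambda>x. u x / U0 lam q \<theta> x) \<longlongrightarrow> 1) (at 0)"
proof -
  interpret hardy_solution \<Omega>0 lam q \<theta> u
    using assms by unfold_locales auto
  define h where "h = (real CARD('n) - 2) / 2"
  have a: "a = 2 * (h - Th)" by (simp add: a_def h_def)
  \<comment> \<open>Completing the square gives \<open>el = a^2 / 4 + (lam - lambda_H)\<close>. Thus
    \<open>lam > lambda_H\<close> is the oscillation condition \<open>el > a^2 / 4\<close>.\<close>
  have el: "el = (h - Th)\<^sup>2 - (lambda_H CARD('n) - lam)"
    by (simp add: el_def ell_def h_def lambda_H_def power2_eq_square field_simps)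
  obtain s0 where dom: "\<And>x. x \<noteq> 0 \<Longrightarrow> ln (norm x) \<le> s0 \<Longrightarrow> x \<in> \<Omega>0 - {0}"
    using log_domain by blast
  obtain c T where el_pos: "el > 0" and c: "c > 0" "\<And>x. x \<noteq> 0 \<Longrightarrow> ln (norm x) \<le> T \<Longrightarrow> c \<le> v x"
    using assms(5)
  proof (elim disjE conjE)
    assume "lam > lambda_H CARD('n)"
    then have gt: "el > a\<^sup>2 / 4" unfolding el a power_mult_distrib by simp
    have "el > 0" using gt zero_le_power2[of a] by linarith
    with lower_bound_oscillating[OF dom gt] that show thesis by metis
  next
    assume le: "lam \<le> lambda_H CARD('n)" and "\<theta> < theta_minus CARD('n) lam q"
    \<comment> \<open>\<open>Th\<close> lies to the left of the smaller root of the quadratic that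
      defines \<open>el\<close>. This gives both \<open>el > 0\<close> and, as that root is at most
      \<open>h\<close>, \<open>a > 0\<close>.\<close>
    then have "Th < p_minus CARD('n) lam"
      using q by (simp add: theta_minus_def Theta_def field_simps)
    then have gt: "sqrt (lambda_H CARD('n) - lam) < h - Th" by (simp add: p_minus_def h_def)
    have nonneg: "0 \<le> sqrt (lambda_H CARD('n) - lam)" using le by simp
    have "(sqrt (lambda_H CARD('n) - lam))\<^sup>2 < (h - Th)\<^sup>2"
      using gt nonneg by (intro power_strict_mono) auto
    then have "el > 0" using le by (simp add: el)
    moreover have "a > 0" using le_less_trans[OF nonneg gt] unfolding a by simp
    ultimately show thesis using lower_bound_damped[OF dom] that by metis
  qed
  have "((\<lambda>x. v x / el powr (1 / (q - 1))) \<longlongrightarrow> 1) (at 0)"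
  proof -
    have "(v \<longlongrightarrow> el powr (1 / (q - 1))) (at 0)" by (rule v_tendsto[OF el_pos c])
    from tendsto_divide[OF this tendsto_const, of "el powr (1 / (q - 1))"] el_pos
    show ?thesis by simp
  qed
  \<comment> \<open>The identity includes the origin, where \<open>0 powr p = 0\<close> and division
    by 0 make both sides 0.\<close>
  moreover have "v x / el powr (1 / (q - 1)) = u x / U0 lam q \<theta> x" for x
    by (simp add: v_def U0_def el_def powr_minus divide_simps)
  ultimately show ?thesis by simp
qed

end
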